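(* For every $n\ge1$, the labeling $\lambda_{\bullet_2}$ is an EL-labeling of $\Pi_n^\bullet$. Consequently, $\Pi_n^\bullet$ is EL-shellable and its maximal intervals are Cohen–Macaulay.
   Context: A pointed set is a pair $(A,p)$, written $A^p$, with $A$ nonempty finite and $p\in A$. A pointed partition of $[n]$ is a collection of pointed sets whose underlying sets form a set partition of $[n]$. In $\Pi_n^\bullet$, $\pi\lessdot\pi'$ exactly when $\pi'$ is obtained from $\pi$ by replacing two blocks $A^p,B^q$ (with $\min A<\min B$) by $(A\cup B)^p$ (a $1$-merge) or $(A\cup B)^q$ (a $0$-merge), other blocks unchanged. The labeling $\lambda_{\bullet_2}$ assigns to a $u$-merge the label $(\min A,\min B)^u$, regarded as an element of the poset $\Lambda_n^w$: for $a\in[n-1]$ let $\Gamma_a=\{(a,b)^u:a<b\le n,u\in\{0,1\}\}$ ordered by $(a,b)^u\le(a,c)^v$ iff $b\le c$ and $u\le v$, and $\Lambda_n^w=\Gamma_1\oplus\cdots\oplus\Gamma_{n-1}$ (ordinal sum: elements of $\Gamma_a$ lie below elements of $\Gamma_{a'}$ when $a<a'$). An edge labeling is an EL-labeling if every closed interval $[x,y]$ has a unique increasing maximal chain (consecutive labels strictly increasing) and this chain's label sequence lexicographically precedes that of every other maximal chain of $[x,y]$ (i.e., at the first position where the sequences differ, the label of the increasing chain is strictly smaller). Maximal intervals are intervals $[\hat0,m]$ with $m$ maximal. *)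

theory Defs
  imports Main "HOL-Library.Disjoint_Sets"
begin

section \<open>Finite posets and EL-labelings\<close>

text \<open>A poset is given by its reflexive order relation \<open>r\<close>; its underlying set is \<open>Field r\<close>.\<close>

definition finite_poset :: "'a rel \<Rightarrow> bool" where
  "finite_poset r \<longleftrightarrow> Partial_order r \<and> finite (Field r)"

definition covers :: "'a rel \<Rightarrow> 'a \<Rightarrow> 'a \<Rightarrow> bool" where
  "covers r x y \<longleftrightarrow> (x, y) \<in> r \<and> x \<noteq> y \<and> (\<forall>z. (x, z) \<in> r \<and> (z, y) \<in> r \<longrightarrow> z = x \<or> z = y)"

definition closed_interval :: "'a rel \<Rightarrow> 'a \<Rightarrow> 'a \<Rightarrow> 'a rel" where
  "closed_interval r x y = Restr r {z. (x, z) \<in> r \<and> (z, y) \<in> r}"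

definition maximal_element :: "'a rel \<Rightarrow> 'a \<Rightarrow> bool" where
  "maximal_element r m \<longleftrightarrow> m \<in> Field r \<and> (\<forall>x. (m, x) \<in> r \<longrightarrow> x = m)"

text \<open>In a finite poset the maximal chains of \<open>[x, y]\<close> are exactly the saturated chains
  from \<open>x\<close> to \<open>y\<close>; they are listed in increasing order.\<close>

definition maximal_chain :: "'a rel \<Rightarrow> 'a \<Rightarrow> 'a \<Rightarrow> 'a list \<Rightarrow> bool" where
  "maximal_chain r x y c \<longleftrightarrow> c \<noteq> [] \<and> hd c = x \<and> last c = y \<and> successively (covers r) c"

definition chain_labels :: "('a \<Rightarrow> 'a \<Rightarrow> 'l) \<Rightarrow> 'a list \<Rightarrow> 'l list" where
  "chain_labels lab c = map2 lab c (tl c)"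

definition increasing_chain :: "'l rel \<Rightarrow> ('a \<Rightarrow> 'a \<Rightarrow> 'l) \<Rightarrow> 'a list \<Rightarrow> bool" where
  "increasing_chain s lab c \<longleftrightarrow> successively (\<lambda>a b. (a, b) \<in> s - Id) (chain_labels lab c)"

text \<open>Here \<open>r\<close> is the labeled poset and \<open>s\<close> is the poset of labels. Only the values of
  \<open>lab x y\<close> on cover relations matter.\<close>

definition EL_labeling :: "'a rel \<Rightarrow> 'l rel \<Rightarrow> ('a \<Rightarrow> 'a \<Rightarrow> 'l) \<Rightarrow> bool" where
  "EL_labeling r s lab \<longleftrightarrow>
     finite_poset r \<and> Partial_order s \<and>
     (\<forall>x y. covers r x y \<longrightarrow> lab x y \<in> Field s) \<and>
     (\<forall>x y. (x, y) \<in> r \<longrightarrow>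
        (\<exists>!c. maximal_chain r x y c \<and> increasing_chain s lab c) \<and>
        (\<forall>c d. maximal_chain r x y c \<and> increasing_chain s lab c \<and>
               maximal_chain r x y d \<and> d \<noteq> c \<longrightarrow>
               (chain_labels lab c, chain_labels lab d) \<in> lexord (s - Id)))"

text \<open>A labeling of a finite poset uses finitely many labels, so it is no restriction to let
  the label poset range over (arbitrary) partial orders on sets of natural numbers.\<close>

definition EL_shellable :: "'a rel \<Rightarrow> bool" where
  "EL_shellable r \<longleftrightarrow> (\<exists>(s :: nat rel) lab. EL_labeling r s lab)"

section \<open>Reduced simplicial homology and the Cohen--Macaulay property\<close>

text \<open>A finite simplicial complex is given by its set of faces, including the empty face.
  The dimension of the complex consisting of the empty face only is \<open>-1\<close>.\<close>

definition complex_dim :: "'a set set \<Rightarrow> int" where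
  "complex_dim \<Delta> = int (Max (card ` \<Delta>)) - 1"

definition link :: "'a set set \<Rightarrow> 'a set \<Rightarrow> 'a set set" where
  "link \<Delta> F = {G \<in> \<Delta>. F \<inter> G = {} \<and> F \<union> G \<in> \<Delta>}"

text \<open>Oriented simplicial \<open>i\<close>-chains with coefficients in a commutative ring: \<open>c [v\<^sub>0, \<dots>, v\<^sub>i]\<close> is
  the coefficient of the oriented simplex \<open>[v\<^sub>0, \<dots>, v\<^sub>i]\<close>, so \<open>c\<close> is alternating in the vertices.
  For \<open>i = -1\<close> the only simplex is \<open>[]\<close>, which makes the complex augmented.\<close>

definition simplicial_chains :: "'a set set \<Rightarrow> int \<Rightarrow> ('a list \<Rightarrow> 'k::comm_ring_1) set" where
  "simplicial_chains \<Delta> i =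
     {c. (\<forall>w. c w \<noteq> 0 \<longrightarrow> distinct w \<and> set w \<in> \<Delta> \<and> int (length w) = i + 1) \<and>
         (\<forall>xs a b ys. c (xs @ a # b # ys) = - c (xs @ b # a # ys))}"

text \<open>Since \<open>[w\<^sub>0, \<dots>, w\<^sub>j]\<close> occurs in the boundary of the oriented simplex \<open>[v, w\<^sub>0, \<dots>, w\<^sub>j]\<close>
  with sign \<open>+1\<close>, the usual alternating boundary takes the following form on coefficients.\<close>

definition simplicial_boundary ::
    "'a set set \<Rightarrow> ('a list \<Rightarrow> 'k::comm_ring_1) \<Rightarrow> 'a list \<Rightarrow> 'k" where
  "simplicial_boundary \<Delta> c = (\<lambda>w. \<Sum>v\<in>\<Union>\<Delta>. c (v # w))"

definition simplicial_cycles :: "'a set set \<Rightarrow> int \<Rightarrow> ('a list \<Rightarrow> 'k::comm_ring_1) set" where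
  "simplicial_cycles \<Delta> i = {c \<in> simplicial_chains \<Delta> i. simplicial_boundary \<Delta> c = (\<lambda>w. 0)}"

definition simplicial_boundaries :: "'a set set \<Rightarrow> int \<Rightarrow> ('a list \<Rightarrow> 'k::comm_ring_1) set" where
  "simplicial_boundaries \<Delta> i = simplicial_boundary \<Delta> ` simplicial_chains \<Delta> (i + 1)"

definition reduced_homology_vanishes ::
    "'k::comm_ring_1 itself \<Rightarrow> 'a set set \<Rightarrow> int \<Rightarrow> bool" where
  "reduced_homology_vanishes _ \<Delta> i \<longleftrightarrow>
     (simplicial_cycles \<Delta> i :: ('a list \<Rightarrow> 'k) set) = simplicial_boundaries \<Delta> i"

definition cohen_macaulay_complex :: "'k::comm_ring_1 itself \<Rightarrow> 'a set set \<Rightarrow> bool" where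
  "cohen_macaulay_complex K \<Delta> \<longleftrightarrow>
     (\<forall>F\<in>\<Delta>. \<forall>i. i < complex_dim (link \<Delta> F) \<longrightarrow> reduced_homology_vanishes K (link \<Delta> F) i)"

definition order_complex :: "'a rel \<Rightarrow> 'a set set" where
  "order_complex r = {F \<in> Chains r. finite F}"

definition cohen_macaulay_poset :: "'k::comm_ring_1 itself \<Rightarrow> 'a rel \<Rightarrow> bool" where
  "cohen_macaulay_poset K r \<longleftrightarrow> finite_poset r \<and> cohen_macaulay_complex K (order_complex r)"

section \<open>The poset of pointed partitions and its labeling\<close>

type_synonym pointed_partition = "(nat set \<times> nat) set"

type_synonym weighted_label = "nat \<times> nat \<times> nat"

definition pointed_partitions :: "nat \<Rightarrow> pointed_partition set" where
  "pointed_partitions n =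
     {\<pi>. partition_on {1..n} (fst ` \<pi>) \<and> inj_on fst \<pi> \<and> (\<forall>(A, p)\<in>\<pi>. p \<in> A)}"

text \<open>\<open>pointed_merge (a, b, u) \<pi> \<pi>'\<close> says that \<open>\<pi>'\<close> arises from \<open>\<pi>\<close> by a \<open>u\<close>-merge of the blocks
  with minima \<open>a < b\<close>; the triple \<open>(a, b, u)\<close> stands for the label \<open>(a, b)\<^sup>u\<close>.\<close>

fun pointed_merge :: "weighted_label \<Rightarrow> pointed_partition \<Rightarrow> pointed_partition \<Rightarrow> bool" where
  "pointed_merge (a, b, u) \<pi> \<pi>' \<longleftrightarrow>
     (\<exists>A p B q. (A, p) \<in> \<pi> \<and> (B, q) \<in> \<pi> \<and> Min A = a \<and> Min B = b \<and> a < b \<and>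
        (u = 1 \<and> \<pi>' = insert (A \<union> B, p) (\<pi> - {(A, p), (B, q)}) \<or>
         u = 0 \<and> \<pi>' = insert (A \<union> B, q) (\<pi> - {(A, p), (B, q)})))"

text \<open>Every merge lowers the number of blocks by one, so the cover relations of the order
  generated by the merges are exactly the merges.\<close>

definition pointed_partition_order :: "nat \<Rightarrow> pointed_partition rel" where
  "pointed_partition_order n =
     {(\<pi>, \<pi>'). \<pi> \<in> pointed_partitions n \<and> \<pi>' \<in> pointed_partitions n \<and>
               (\<lambda>\<sigma> \<tau>. \<exists>l. pointed_merge l \<sigma> \<tau>)\<^sup>*\<^sup>* \<pi> \<pi>'}"

definition pointed_bottom :: "nat \<Rightarrow> pointed_partition" where
  "pointed_bottom n = (\<lambda>i. ({i}, i)) ` {1..n}"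

definition weighted_labels :: "nat \<Rightarrow> nat \<Rightarrow> weighted_label set" where
  "weighted_labels n a = {(a, b, u) | b u. a < b \<and> b \<le> n \<and> u \<in> {0, 1}}"

definition weighted_label_order :: "nat \<Rightarrow> weighted_label rel" where
  "weighted_label_order n =
     {((a, b, u), (a', c, v)) | a b u a' c v.
        a \<in> {1..n - 1} \<and> (a, b, u) \<in> weighted_labels n a \<and>
        a' \<in> {1..n - 1} \<and> (a', c, v) \<in> weighted_labels n a' \<and>
        (a < a' \<or> a = a' \<and> b \<le> c \<and> u \<le> v)}"

text \<open>The label of a merge is determined by the two partitions involved.\<close>

definition bullet_label :: "pointed_partition \<Rightarrow> pointed_partition \<Rightarrow> weighted_label" where
  "bullet_label \<pi> \<pi>' = (THE l. pointed_merge l \<pi> \<pi>')"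

end

theory Submission
  imports Defs "HOL-Library.Countable"
begin

text \<open>One has \<open>x \<le> y\<close> iff every block of \<open>x\<close> lies in a block of \<open>y\<close> and every pointer of \<open>y\<close> is a pointer
  of \<open>x\<close>; hence the merges of \<open>x\<close> that stay below \<open>y\<close> are explicit. Their labels have a least element
  \<open>low x y\<close>, and after a merge \<open>x \<rightarrow> z\<close> with label \<open>l\<close> one has \<open>l < low z y\<close> exactly if \<open>l = low x y\<close>.
  So the increasing chain is the greedy one that always takes the least label, and it is
  lexicographically first.

  For the Cohen--Macaulay property, order the maximal chains of an interval lexicographically. The
  faces of such a chain \<open>c\<close> that lie on no earlier chain are those containing all descents of
  \<open>c\<close>. Adding the chains one by one, a cycle below the top dimension is pushed off the new faces by
  coning with a vertex of \<open>c\<close> that is not a descent. Links inherit this structure.\<close>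

section \<open>A local criterion for EL-labelings\<close>

text \<open>Labels with the same first entry \<open>a\<close> are ordered as a product, so a set of
  labels need not have a least one and the greedy choice could be ambiguous. It is not, because of
  how pointers are lost. Merging blocks with pointers \<open>p\<close> and \<open>q\<close> inside a
  block of \<open>y\<close> with pointer \<open>r\<close> forgets \<open>p\<close> (weight 0) or
  \<open>q\<close> (weight 1), and \<open>y\<close> stays reachable exactly if the forgotten pointer
  is not \<open>r\<close>. Hence weight 0 is possible for all partners of the block with minimum
  \<open>a\<close> or for none, so the second entry and the weight can be minimised independently.

  Label sequences are only partially ordered as well, and distinct chains may be incomparable. The
  homology argument therefore works with sets of chains closed under passing to earlier ones, and
  splits off a maximal chain of such a set. Coefficients lie in an arbitrary commutative ring, so no
  sign argument may divide by 2.\<close>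

lemma maximal_chain_Cons:
  "maximal_chain r x y (a # c) \<longleftrightarrow>
     a = x \<and> (c = [] \<and> x = y \<or> c \<noteq> [] \<and> covers r x (hd c) \<and> maximal_chain r (hd c) y c)"
  by (cases c) (auto simp: maximal_chain_def)

lemma maximal_chain_append:
  assumes "maximal_chain r x y (c @ [y])" "maximal_chain r y z (y # d)"
  shows "maximal_chain r x z (c @ y # d)"
  using assms by (auto simp: maximal_chain_def successively_append_iff hd_append split: if_splits)

lemma maximal_chain_split:
  assumes "maximal_chain r x z (c @ y # d)"
  shows "maximal_chain r x y (c @ [y])" "maximal_chain r y z (y # d)"
  using assms by (auto simp: maximal_chain_def successively_append_iff hd_append split: if_splits)

lemma chain_labels_Cons_Cons [simp]:
  "chain_labels lab (a # b # c) = lab a b # chain_labels lab (b # c)"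
  by (simp add: chain_labels_def)

lemma chain_labels_singleton [simp]: "chain_labels lab [a] = []"
  by (simp add: chain_labels_def)

lemma chain_labels_append:
  "chain_labels lab (c @ a # d) = chain_labels lab (c @ [a]) @ chain_labels lab (a # d)"
proof (induction c)
  case (Cons b c)
  then show ?case by (cases c) auto
qed simp

lemma length_chain_labels [simp]: "length (chain_labels lab c) = length c - 1"
  by (simp add: chain_labels_def)

text \<open>The list \<open>[x]\<close> counts as a maximal chain from \<open>x\<close> to
  \<open>x\<close> for every \<open>x\<close>, even outside the poset; hence the hypothesis
  \<open>x \<in> Field r\<close>.\<close>

lemma maximal_chain_le:
  assumes "Partial_order r" "maximal_chain r x y c" "x \<in> Field r" "z \<in> set c"
  shows "(x, z) \<in> r \<and> (z, y) \<in> r"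
  using assms(2-4)
proof (induction c arbitrary: x z)
  case Nil
  then show ?case by simp
next
  case (Cons a c)
  have tr: "trans r" and rf: "Refl r"
    using assms(1) by (auto simp: order_on_defs)
  show ?case
  proof (cases c)
    case Nil
    with Cons.prems rf show ?thesis
      by (auto simp: maximal_chain_def refl_on_def)
  next
    case (Cons b c')
    with Cons.prems have *: "covers r x b" "maximal_chain r b y c" "a = x"
      by (auto simp: maximal_chain_Cons)
    then have b: "b \<in> Field r" "(x, b) \<in> r" by (auto simp: covers_def Field_def)
    have "(b, y) \<in> r" using Cons.IH[OF *(2) b(1), of b] Cons by simp
    then have "(x, y) \<in> r" using b tr by (meson transD)
    show ?thesis
    proof (cases "z = x")
      case True
      then show ?thesis using \<open>(x, y) \<in> r\<close> Cons.prems rf by (auto simp: refl_on_def)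
    next
      case False
      with Cons.prems * have "z \<in> set c" by auto
      from Cons.IH[OF *(2) b(1) this] show ?thesis using b tr by (meson transD)
    qed
  qed
qed

lemma distinct_maximal_chain:
  assumes "Partial_order r" "maximal_chain r x y c"
  shows "distinct c"
  using assms(2)
proof (induction c arbitrary: x)
  case (Cons a c)
  show ?case
  proof (cases c)
    case (Cons b c')
    with Cons.prems have *: "covers r x b" "maximal_chain r b y c" "a = x"
      by (auto simp: maximal_chain_Cons)
    have "x \<notin> set c"
    proof
      assume "x \<in> set c"
      moreover have "b \<in> Field r" using * by (auto simp: covers_def Field_def)
      ultimately have "(b, x) \<in> r" using maximal_chain_le[OF assms(1) *(2)] by blast
      with * assms(1) show False by (auto simp: covers_def order_on_defs antisym_def)
    qed
    with Cons.IH[OF *(2)] * show ?thesis by simp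
  qed simp
qed simp

lemma irrefl_lexord_strict: "(l, l) \<notin> lexord (s - Id)"
  by (rule lexord_irreflexive) simp

lemma trans_lexord_strict: 
  assumes "Partial_order s" shows "trans (lexord (s - Id))"
proof -
  have "trans (s - Id)" using assms by (simp add: order_on_defs trans_diff_Id)
  then show ?thesis by (rule lexord_transI)
qed

text \<open>\<open>low x y\<close> stands for the least label of an atom of \<open>[x, y]\<close>.
  The equivalence in \<open>step\<close> is used both ways: from right to left it makes the greedy
  chain increasing, from left to right it forces every increasing chain to be greedy.
  \<open>ex1\<close> then leaves one chain.\<close>

theorem EL_labelingI:
  assumes r: "finite_poset r" and s: "Partial_order s"
    and least: "\<And>x z y. covers r x z \<Longrightarrow> (z, y) \<in> r \<Longrightarrow> (low x y, lab x z) \<in> s"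
    and ex1: "\<And>x y. (x, y) \<in> r \<Longrightarrow> x \<noteq> y \<Longrightarrow> \<exists>!z. covers r x z \<and> (z, y) \<in> r \<and> lab x z = low x y"
    and step: "\<And>x z y. covers r x z \<Longrightarrow> (z, y) \<in> r \<Longrightarrow> z \<noteq> y \<Longrightarrow>
      (lab x z, low z y) \<in> s - Id \<longleftrightarrow> lab x z = low x y"
  shows "EL_labeling r s lab"
proof -
  have po: "Partial_order r" and fin: "finite (Field r)"
    using r by (auto simp: finite_poset_def)
  then have tr: "trans r" and rf: "Refl r" and anti: "antisym r"
    by (auto simp: order_on_defs)
  \<comment> \<open>Induction along the chain: the label after \<open>z\<close> is already known to
    be \<open>low z y\<close>, so the increase at \<open>z\<close> is exactly the condition in
    \<open>step\<close>. For a single edge \<open>z = y\<close>, and the atom provided by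
    \<open>ex1\<close> can only be \<open>y\<close>.\<close>
  have first: "lab x z = low x y"
    if "maximal_chain r x y (x # z # c)" "increasing_chain s lab (x # z # c)" for x y z c
    using that
  proof (induction c arbitrary: x z)
    case Nil
    then have y: "z = y" "covers r x y" by (auto simp: maximal_chain_def)
    then have "(x, y) \<in> r" "x \<noteq> y" by (auto simp: covers_def)
    from ex1[OF this] obtain w where "covers r x w" "(w, y) \<in> r" "lab x w = low x y" by blast
    with y have "w = y" by (auto simp: covers_def)
    with \<open>lab x w = low x y\<close> y show ?case by simp
  next
    case (Cons w c)
    have mc: "maximal_chain r z y (z # w # c)" and cov: "covers r x z"
      using Cons.prems by (auto simp: maximal_chain_Cons)
    have "increasing_chain s lab (z # w # c)" "(lab x z, lab z w) \<in> s - Id"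
      using Cons.prems by (auto simp: increasing_chain_def)
    with Cons.IH[OF mc] have *: "(lab x z, low z y) \<in> s - Id" by simp
    have z: "z \<in> Field r" using cov by (auto simp: covers_def Field_def)
    have "(z, y) \<in> r" using maximal_chain_le[OF po mc z, of z] by simp
    moreover have "z \<noteq> y"
      using distinct_maximal_chain[OF po mc] mc by (auto simp: maximal_chain_def split: if_splits)
    ultimately show ?case using step[OF cov] * by blast
  qed
  \<comment> \<open>With \<open>d\<close> arbitrary this yields uniqueness as well: two distinct
    increasing chains would precede each other, against transitivity and irreflexivity.\<close>
  have precedes: "d = c \<or> (chain_labels lab c, chain_labels lab d) \<in> lexord (s - Id)"
    if "maximal_chain r x y c" "increasing_chain s lab c" "maximal_chain r x y d" for x y c d
    using that
  proof (induction c arbitrary: x d)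
    case (Cons a c)
    have a: "a = x" using Cons.prems by (simp add: maximal_chain_Cons)
    obtain d' where d: "d = x # d'"
      using Cons.prems(3) by (cases d) (auto simp: maximal_chain_def)
    show ?case
    proof (cases "x = y")
      case True
      with Cons.prems a d distinct_maximal_chain[OF po Cons.prems(1)]
        distinct_maximal_chain[OF po Cons.prems(3)]
      show ?thesis by (auto simp: maximal_chain_def split: if_splits)
    next
      case False
      obtain z c' where c: "c = z # c'"
        using Cons.prems False by (cases c) (auto simp: maximal_chain_Cons)
      obtain w d'' where d': "d' = w # d''"
        using Cons.prems d False by (cases d') (auto simp: maximal_chain_Cons)
      have mc: "maximal_chain r z y c" "covers r x z" and md: "maximal_chain r w y d'" "covers r x w"
        using Cons.prems c d d' by (auto simp: maximal_chain_Cons)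
      have zw: "(z, y) \<in> r" "(w, y) \<in> r"
        using maximal_chain_le[OF po mc(1), of z] maximal_chain_le[OF po md(1), of w] mc md c d'
        by (auto simp: covers_def Field_def)
      have xy: "(x, y) \<in> r" using mc zw tr by (auto simp: covers_def dest: transD)
      have lz: "lab x z = low x y" using first[of x y z c'] Cons.prems a c by simp
      have lw: "(low x y, lab x w) \<in> s" using least md zw by blast
      show ?thesis
      proof (cases "lab x w = low x y")
        case True
        with ex1[OF xy False] mc md zw lz have "w = z" by blast
        have "increasing_chain s lab c" using Cons.prems(2) c a
          by (cases c') (auto simp: increasing_chain_def)
        from Cons.IH[OF mc(1) this] md \<open>w = z\<close>
        have "d' = c \<or> (chain_labels lab c, chain_labels lab d') \<in> lexord (s - Id)" by simp
        then show ?thesis using a c d d' \<open>w = z\<close> by auto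
      next
        case False
        then show ?thesis using lw lz a c d d' by auto
      qed
    qed
  qed (simp add: maximal_chain_def)
  have exist: "\<exists>c. maximal_chain r x y c \<and> increasing_chain s lab c" if "(x, y) \<in> r" for x y
    using that
  proof (induction "card {z. (x, z) \<in> r}" arbitrary: x rule: less_induct)
    case less
    show ?case
    proof (cases "x = y")
      case True
      then have "maximal_chain r x y [x] \<and> increasing_chain s lab [x]"
        by (simp add: maximal_chain_def increasing_chain_def chain_labels_def)
      then show ?thesis by blast
    next
      case False
      from ex1[OF less.prems False] obtain z
        where z: "covers r x z" "(z, y) \<in> r" "lab x z = low x y" by blast
      then have xz: "(x, z) \<in> r" "x \<noteq> z" by (auto simp: covers_def)
      then have "{w. (z, w) \<in> r} \<subseteq> {w. (x, w) \<in> r}" "x \<notin> {w. (z, w) \<in> r}" "x \<in> {w. (x, w) \<in> r}"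
        using tr anti rf by (auto simp: antisym_def refl_on_def Field_def dest: transD)
      then have "{w. (z, w) \<in> r} \<subset> {w. (x, w) \<in> r}" by blast
      moreover have "finite {w. (x, w) \<in> r}"
        by (rule finite_subset[OF _ fin]) (auto simp: Field_def)
      ultimately have "card {w. (z, w) \<in> r} < card {w. (x, w) \<in> r}" by (rule psubset_card_mono[rotated])
      from less.hyps[OF this z(2)] obtain c where c: "maximal_chain r z y c" "increasing_chain s lab c"
        by blast
      then obtain c' where c': "c = z # c'" by (cases c) (auto simp: maximal_chain_def)
      have "maximal_chain r x y (x # c)" using c c' z by (simp add: maximal_chain_Cons)
      moreover have "increasing_chain s lab (x # c)"
      proof (cases c')
        case Nil
        then show ?thesis using c' by (simp add: increasing_chain_def)
      next
        case (Cons w c'')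
        then have lw: "lab z w = low z y" using first c c' by simp
        have "z \<noteq> y" using distinct_maximal_chain[OF po c(1)] c c' Cons
          by (auto simp: maximal_chain_def split: if_splits)
        with step z have "(lab x z, low z y) \<in> s - Id" by blast
        then show ?thesis using c c' Cons lw by (simp add: increasing_chain_def)
      qed
      ultimately show ?thesis by blast
    qed
  qed
  have "lab x y \<in> Field s" if "covers r x y" for x y
  proof -
    have "(y, y) \<in> r" using that rf by (auto simp: covers_def refl_on_def Field_def)
    from least[OF that this] show ?thesis by (auto simp: Field_def)
  qed
  moreover have "\<exists>!c. maximal_chain r x y c \<and> increasing_chain s lab c" if "(x, y) \<in> r" for x y
  proof -
    have "c = d" if "maximal_chain r x y c \<and> increasing_chain s lab c"
      "maximal_chain r x y d \<and> increasing_chain s lab d" for c d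
      using precedes[of x y c d] precedes[of x y d c] that
        transD[OF trans_lexord_strict[OF s]] irrefl_lexord_strict by metis
    then show ?thesis using exist[OF that] by blast
  qed
  ultimately show ?thesis unfolding EL_labeling_def using r s precedes by blast
qed

section \<open>Transport of labels to natural numbers\<close>

lemma lexord_map_iff:
  assumes "\<And>a b. (f a, f b) \<in> s' \<longleftrightarrow> (a, b) \<in> s" and "inj f"
  shows "(map f u, map f v) \<in> lexord s' \<longleftrightarrow> (u, v) \<in> lexord s"
proof (induction u arbitrary: v)
  case Nil
  then show ?case by (cases v) auto
next
  case (Cons a u)
  then show ?case using assms by (cases v) (auto dest: injD)
qed

text \<open>The label order is carried along the injection \<open>to_nat\<close> and has no relation
  to the usual order of \<open>nat\<close>.\<close>

lemma EL_labeling_imp_EL_shellable: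
  fixes lab :: "'a \<Rightarrow> 'a \<Rightarrow> 'l::countable"
  assumes "EL_labeling r s lab"
  shows "EL_shellable r"
proof -
  let ?f = "to_nat :: 'l \<Rightarrow> nat"
  let ?s = "map_prod ?f ?f ` s"
  let ?lab = "\<lambda>x y. ?f (lab x y)"
  have mem: "(?f a, ?f b) \<in> ?s - Id \<longleftrightarrow> (a, b) \<in> s - Id" for a b by force
  have labels: "chain_labels ?lab c = map ?f (chain_labels lab c)" for c
    by (simp add: chain_labels_def zip_map_map case_prod_unfold)
  have inc: "increasing_chain ?s ?lab c \<longleftrightarrow> increasing_chain s lab c" for c
    unfolding increasing_chain_def labels successively_map using mem by simp
  have lex: "(chain_labels ?lab c, chain_labels ?lab d) \<in> lexord (?s - Id) \<longleftrightarrow>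
    (chain_labels lab c, chain_labels lab d) \<in> lexord (s - Id)" for c d
    unfolding labels by (rule lexord_map_iff) (use mem in auto)
  have Field: "Field ?s = ?f ` Field s" by (force simp: Field_def)
  have s: "refl_on (Field s) s" "trans s" "antisym s"
    using assms by (simp_all add: EL_labeling_def order_on_defs)
  have "refl_on (Field ?s) ?s"
    unfolding Field using s(1) by (force simp: refl_on_def)
  moreover have "trans ?s"
    by (rule transI) (use s(2) in \<open>auto dest: transD\<close>)
  moreover have "antisym ?s"
    by (rule antisymI) (use s(3) in \<open>auto dest: antisymD\<close>)
  ultimately have "Partial_order ?s" by (auto simp: order_on_defs intro: FieldI1 FieldI2)
  then have "EL_labeling r ?s ?lab"
    using assms unfolding EL_labeling_def inc lex Field by blast
  then show ?thesis unfolding EL_shellable_def by blast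
qed

section \<open>Homology of shellable complexes\<close>

lemma alternating_zero_move:
  fixes c :: "'a list \<Rightarrow> 'k::comm_ring_1"
  assumes alt: "\<And>xs a b ys. c (xs @ a # b # ys) = - c (xs @ b # a # ys)"
    and "c (v # p @ q) = 0"
  shows "c (p @ v # q) = 0"
  using assms(2)
proof (induction p arbitrary: q rule: rev_induct)
  case (snoc a p)
  then have "c (p @ v # a # q) = 0" by simp
  then show ?case using alt[of p a v q] by simp
qed simp

text \<open>The boundary sums over the vertices of the complex and so depends on
  \<open>\<Delta>\<close>. A vertex outside \<open>\<Delta>'\<close> contributes zero, because no
  simplex carrying a coefficient contains it.\<close>

lemma simplicial_boundary_mono:
  assumes "c \<in> simplicial_chains \<Delta>' i" "\<Delta>' \<subseteq> \<Delta>" "finite (\<Union>\<Delta>)"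
  shows "simplicial_boundary \<Delta> c = simplicial_boundary \<Delta>' c"
proof
  fix w
  have "c (v # w) = 0" if "v \<in> \<Union>\<Delta> - \<Union>\<Delta>'" for v
  proof (rule ccontr)
    assume "c (v # w) \<noteq> 0"
    then have "set (v # w) \<in> \<Delta>'" using assms(1) unfolding simplicial_chains_def by blast
    then show False using that by auto
  qed
  then show "simplicial_boundary \<Delta> c w = simplicial_boundary \<Delta>' c w"
    unfolding simplicial_boundary_def
    by (intro sum.mono_neutral_right) (use assms in auto)
qed

lemma simplicial_chains_mono:
  "\<Delta>' \<subseteq> \<Delta> \<Longrightarrow> simplicial_chains \<Delta>' i \<subseteq> simplicial_chains \<Delta> i"
  unfolding simplicial_chains_def by blast

lemma simplicial_chains_support:
  "c \<in> simplicial_chains \<Delta> i \<Longrightarrow> c w \<noteq> 0 \<Longrightarrow> distinct w \<and> set w \<in> \<Delta> \<and> int (length w) = i + 1"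
  unfolding simplicial_chains_def by blast

lemma simplicial_chains_swap:
  "c \<in> simplicial_chains \<Delta> i \<Longrightarrow> c (xs @ a # b # ys) = - c (xs @ b # a # ys)"
  unfolding simplicial_chains_def by blast

lemma simplicial_chains_add:
  assumes "b \<in> simplicial_chains \<Delta> i" "c \<in> simplicial_chains \<Delta> i"
  shows "(\<lambda>w. b w + c w) \<in> simplicial_chains \<Delta> i"
  unfolding simplicial_chains_def
proof (intro CollectI conjI allI impI)
  fix w assume "b w + c w \<noteq> 0"
  then have "b w \<noteq> 0 \<or> c w \<noteq> 0" by auto
  then show "distinct w" "set w \<in> \<Delta>" "int (length w) = i + 1"
    using simplicial_chains_support assms by metis+
next
  fix xs x y ys
  show "b (xs @ x # y # ys) + c (xs @ x # y # ys) = - (b (xs @ y # x # ys) + c (xs @ y # x # ys))"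
    using assms[THEN simplicial_chains_swap, of xs x y ys] by simp
qed

lemma simplicial_chains_uminus:
  assumes "c \<in> simplicial_chains \<Delta> i"
  shows "(\<lambda>w. - c w) \<in> simplicial_chains \<Delta> i"
  unfolding simplicial_chains_def
proof (intro CollectI conjI allI impI)
  fix w assume "- c w \<noteq> 0"
  then show "distinct w" "set w \<in> \<Delta>" "int (length w) = i + 1"
    using simplicial_chains_support[OF assms] by simp_all
next
  fix xs x y ys
  show "- c (xs @ x # y # ys) = - (- c (xs @ y # x # ys))"
    using simplicial_chains_swap[OF assms, of xs x y ys] by simp
qed

lemma simplicial_chains_diff:
  "b \<in> simplicial_chains \<Delta> i \<Longrightarrow> c \<in> simplicial_chains \<Delta> i \<Longrightarrow> (\<lambda>w. b w - c w) \<in> simplicial_chains \<Delta> i"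
  using simplicial_chains_add[OF _ simplicial_chains_uminus, of b \<Delta> i c] by simp

lemma simplicial_boundary_add:
  "simplicial_boundary \<Delta> (\<lambda>w. b w + c w) = (\<lambda>w. simplicial_boundary \<Delta> b w + simplicial_boundary \<Delta> c w)"
  by (simp add: simplicial_boundary_def sum.distrib)

lemma simplicial_boundary_diff:
  "simplicial_boundary \<Delta> (\<lambda>w. b w - c w) = (\<lambda>w. simplicial_boundary \<Delta> b w - simplicial_boundary \<Delta> c w)"
  by (simp add: simplicial_boundary_def sum_subtractf)

lemma simplicial_boundary_in_chains:
  fixes c :: "'a list \<Rightarrow> 'k::comm_ring_1"
  assumes c: "c \<in> simplicial_chains \<Delta> (i + 1)" and down: "\<And>F G. F \<in> \<Delta> \<Longrightarrow> G \<subseteq> F \<Longrightarrow> G \<in> \<Delta>"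
  shows "simplicial_boundary \<Delta> c \<in> simplicial_chains \<Delta> i"
  unfolding simplicial_chains_def
proof (intro CollectI conjI allI impI)
  fix w assume "simplicial_boundary \<Delta> c w \<noteq> 0"
  then obtain v where "c (v # w) \<noteq> 0"
    unfolding simplicial_boundary_def by (meson sum.neutral)
  then have *: "distinct (v # w)" "set (v # w) \<in> \<Delta>" "int (length (v # w)) = i + 1 + 1"
    using c unfolding simplicial_chains_def by blast+
  then show "distinct w" "int (length w) = i + 1" by auto
  show "set w \<in> \<Delta>" using down[OF *(2)] by auto
next
  fix xs a b ys
  have "c ((v # xs) @ a # b # ys) = - c ((v # xs) @ b # a # ys)" for v
    using c unfolding simplicial_chains_def by blast
  then show "simplicial_boundary \<Delta> c (xs @ a # b # ys) = - simplicial_boundary \<Delta> c (xs @ b # a # ys)"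
    by (simp add: simplicial_boundary_def sum_negf)
qed

text \<open>Antisymmetry alone does not suffice here, since \<open>2\<close> may be a zero divisor.\<close>

lemma sum_alternating_eq_0:
  fixes f :: "'a \<Rightarrow> 'a \<Rightarrow> 'k::comm_ring_1"
  assumes "\<And>u v. f u v = - f v u" "\<And>u. f u u = 0"
  shows "(\<Sum>u\<in>A. \<Sum>v\<in>A. f u v) = 0"
proof (induction A rule: infinite_finite_induct)
  case (insert a A)
  have "(\<Sum>u\<in>A. f u a) = - (\<Sum>v\<in>A. f a v)"
    using assms(1) by (metis (no_types, lifting) sum.cong sum_negf)
  with insert show ?case by (simp add: sum.distrib assms(2))
qed simp_all

text \<open>On coefficients, the boundary applied twice sums over all ordered pairs of vertices put
  in front of \<open>w\<close>. Exchanging the two reverses the sign, and the diagonal vanishes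
  because a list with a repetition has coefficient zero.\<close>

lemma simplicial_boundary_boundary:
  fixes c :: "'a list \<Rightarrow> 'k::comm_ring_1"
  assumes "c \<in> simplicial_chains \<Delta> i"
  shows "simplicial_boundary \<Delta> (simplicial_boundary \<Delta> c) = (\<lambda>w. 0)"
proof
  fix w
  show "simplicial_boundary \<Delta> (simplicial_boundary \<Delta> c) w = 0"
    unfolding simplicial_boundary_def
  proof (rule sum_alternating_eq_0)
    show "c (v # u # w) = - c (u # v # w)" for u v
      using simplicial_chains_swap[OF assms, of "[]" v u w] unfolding append_Nil .
    show "c (u # u # w) = 0" for u
      using simplicial_chains_support[OF assms, of "u # u # w"] by auto
  qed
qed

lemma simplicial_boundaries_subset_cycles:
  assumes "\<And>F G. F \<in> \<Delta> \<Longrightarrow> G \<subseteq> F \<Longrightarrow> G \<in> \<Delta>"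
  shows "simplicial_boundaries \<Delta> i \<subseteq> simplicial_cycles \<Delta> i"
proof
  fix z assume "z \<in> simplicial_boundaries \<Delta> i"
  then obtain c where c: "c \<in> simplicial_chains \<Delta> (i + 1)" "z = simplicial_boundary \<Delta> c"
    unfolding simplicial_boundaries_def by blast
  have "z \<in> simplicial_chains \<Delta> i"
    unfolding c(2) by (rule simplicial_boundary_in_chains[OF c(1)]) (rule assms)
  then show "z \<in> simplicial_cycles \<Delta> i"
    using simplicial_boundary_boundary[OF c(1)] c(2) by (simp add: simplicial_cycles_def)
qed

text \<open>The cone with apex \<open>v\<close> over the part of \<open>z\<close> carried by
  \<open>N\<close>. Chains are functions on ordered simplices, so the coefficient at
  \<open>u\<close> arises by moving \<open>v\<close> to the front, with one sign for each vertex
  passed. Requiring \<open>v\<close> to disappear with one removal excludes repetitions of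
  \<open>v\<close>.\<close>

definition cone_chain :: "'a \<Rightarrow> 'a set set \<Rightarrow> ('a list \<Rightarrow> 'k::comm_ring_1) \<Rightarrow> 'a list \<Rightarrow> 'k" where
  "cone_chain v N z u =
     (if v \<in> set u \<and> v \<notin> set (remove1 v u) \<and> set (remove1 v u) \<in> N
      then (- 1) ^ length (takeWhile (\<lambda>x. x \<noteq> v) u) * z (remove1 v u) else 0)"

lemma cone_chain_in_chains:
  fixes z :: "'a list \<Rightarrow> 'k::comm_ring_1"
  assumes z: "z \<in> simplicial_chains \<Delta> i" and N: "\<And>G. G \<in> N \<Longrightarrow> insert v G \<in> \<Delta>"
  shows "cone_chain v N z \<in> simplicial_chains \<Delta> (i + 1)"
  unfolding simplicial_chains_def
proof (intro CollectI conjI allI impI)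
  fix w assume "cone_chain v N z w \<noteq> 0"
  then have w: "v \<in> set w" "v \<notin> set (remove1 v w)" "set (remove1 v w) \<in> N" "z (remove1 v w) \<noteq> 0"
    by (auto simp: cone_chain_def split: if_splits)
  then have r: "distinct (remove1 v w)" "int (length (remove1 v w)) = i + 1"
    using z unfolding simplicial_chains_def by blast+
  obtain p q where pq: "w = p @ v # q" "v \<notin> set p" using w(1) by (meson split_list_first)
  then have "remove1 v w = p @ q" by (simp add: remove1_append)
  with pq r w(2) N[OF w(3)]
  show "distinct w" "int (length w) = i + 1 + 1" "set w \<in> \<Delta>" by auto
next
  fix xs a b ys
  have alt: "z (p @ a # b # q) = - z (p @ b # a # q)" for p a b q
    using z unfolding simplicial_chains_def by blast
  have tw: "takeWhile (\<lambda>x. x \<noteq> v) (xs @ c) = xs @ takeWhile (\<lambda>x. x \<noteq> v) c" if "v \<notin> set xs" for c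
    using that by (intro takeWhile_append2) auto
  have tw': "takeWhile (\<lambda>x. x \<noteq> v) (xs @ c) = takeWhile (\<lambda>x. x \<noteq> v) xs" if "v \<in> set xs" for c
    using that by (intro takeWhile_append1) auto
  have sets: "set (remove1 v (xs @ a # b # ys)) = set (remove1 v (xs @ b # a # ys))"
    by (auto simp: remove1_append)
  show "cone_chain v N z (xs @ a # b # ys) = - cone_chain v N z (xs @ b # a # ys)"
  \<comment> \<open>The position of \<open>v\<close> decides which factor changes sign. If
    \<open>v\<close> precedes or follows both swapped vertices, \<open>z\<close> does; if it is
    exactly one of them, the list without \<open>v\<close> is unchanged and the exponent changes by
    one.\<close>
  proof (cases "v \<in> set xs")
    case True
    then show ?thesis
      unfolding cone_chain_def sets using alt[of "remove1 v xs" a b ys]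
      by (simp add: remove1_append tw')
  next
    case False
    show ?thesis
    proof (cases "a = v \<or> b = v")
      case True
      then show ?thesis using False by (auto simp: cone_chain_def remove1_append tw)
    next
      case F: False
      have tws: "length (takeWhile (\<lambda>x. x \<noteq> v) (xs @ a # b # ys)) =
        length (takeWhile (\<lambda>x. x \<noteq> v) (xs @ b # a # ys))"
        using False F by (simp add: tw)
      have "z (remove1 v (xs @ a # b # ys)) = - z (remove1 v (xs @ b # a # ys))"
        using alt[of xs a b "remove1 v ys"] False F by (auto simp: remove1_append)
      then show ?thesis unfolding cone_chain_def sets tws by auto
    qed
  qed
qed

lemma cone_chain_Cons: "v \<notin> set w \<Longrightarrow> set w \<in> N \<Longrightarrow> cone_chain v N z (v # w) = z w"
  by (simp add: cone_chain_def)

text \<open>The new faces form the interval between \<open>R\<close> and \<open>F\<close>. A cycle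
  vanishing on it is a cycle of \<open>\<Delta>'\<close> and bounds there, so it suffices to change
  a cycle by a boundary until it vanishes on the new faces. A vertex \<open>v\<close> in
  \<open>F - R\<close> makes this possible, since adding or removing \<open>v\<close> does not leave
  the interval.\<close>

lemma cycles_subset_boundaries_insert_facet:
  assumes \<Delta>: "\<Delta> = \<Delta>' \<union> Pow F" and fin: "finite (\<Union>\<Delta>)"
    and down: "\<And>G H. G \<in> \<Delta>' \<Longrightarrow> H \<subseteq> G \<Longrightarrow> H \<in> \<Delta>'"
    and new: "\<And>G. G \<subseteq> F \<Longrightarrow> G \<notin> \<Delta>' \<longleftrightarrow> R \<subseteq> G"
    and R: "R \<subseteq> F" and i: "i + 1 < int (card F)"
    and IH: "simplicial_cycles \<Delta>' i \<subseteq> (simplicial_boundaries \<Delta>' i :: ('a list \<Rightarrow> 'k::comm_ring_1) set)"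
  shows "simplicial_cycles \<Delta> i \<subseteq> (simplicial_boundaries \<Delta> i :: ('a list \<Rightarrow> 'k) set)"
proof
  let ?N = "{G. R \<subseteq> G \<and> G \<subseteq> F}"
  have sub: "\<Delta>' \<subseteq> \<Delta>" using \<Delta> by blast
  have down\<Delta>: "H \<in> \<Delta>" if "G \<in> \<Delta>" "H \<subseteq> G" for G H using that \<Delta> down by blast
  have new_faces: "G \<in> ?N" if "G \<in> \<Delta>" "G \<notin> \<Delta>'" for G using that \<Delta> new by blast
  have old: "z \<in> simplicial_boundaries \<Delta> i"
    if "z \<in> simplicial_cycles \<Delta> i" "\<And>w. set w \<in> ?N \<Longrightarrow> z w = 0" for z :: "'a list \<Rightarrow> 'k"
  proof -
    have zc: "z \<in> simplicial_chains \<Delta> i" using that(1) by (simp add: simplicial_cycles_def)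
    have "set w \<in> \<Delta>'" if "z w \<noteq> 0" for w
    proof (rule ccontr)
      assume "set w \<notin> \<Delta>'"
      moreover have "set w \<in> \<Delta>" using zc that unfolding simplicial_chains_def by blast
      ultimately have "set w \<in> ?N" using new_faces by blast
      then show False using \<open>\<And>w. set w \<in> ?N \<Longrightarrow> z w = 0\<close> that by blast
    qed
    with zc have z': "z \<in> simplicial_chains \<Delta>' i" unfolding simplicial_chains_def by blast
    have "simplicial_boundary \<Delta>' z = (\<lambda>w. 0)"
      using simplicial_boundary_mono[OF z' sub fin] that(1) by (simp add: simplicial_cycles_def)
    with z' have "z \<in> simplicial_boundaries \<Delta>' i" using IH by (auto simp: simplicial_cycles_def)
    then obtain b where b: "b \<in> simplicial_chains \<Delta>' (i + 1)" "z = simplicial_boundary \<Delta>' b"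
      by (auto simp: simplicial_boundaries_def)
    have "z = simplicial_boundary \<Delta> b"
      using b(2) simplicial_boundary_mono[OF b(1) sub fin] by simp
    moreover have "b \<in> simplicial_chains \<Delta> (i + 1)" using b(1) simplicial_chains_mono[OF sub] by blast
    ultimately show ?thesis unfolding simplicial_boundaries_def by blast
  qed
  fix z :: "'a list \<Rightarrow> 'k" assume z: "z \<in> simplicial_cycles \<Delta> i"
  then have zc: "z \<in> simplicial_chains \<Delta> i" by (simp add: simplicial_cycles_def)
  show "z \<in> simplicial_boundaries \<Delta> i"
  proof (cases "R = F")
    \<comment> \<open>The only new face is \<open>F\<close> itself, which has too many vertices for
      a simplex of dimension \<open>i\<close>.\<close>
    case True
    have "z w = 0" if "set w \<in> ?N" for w
    proof (rule ccontr)
      assume "z w \<noteq> 0"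
      then have "distinct w" "int (length w) = i + 1" using zc unfolding simplicial_chains_def by blast+
      with that True i show False by (auto simp flip: distinct_card)
    qed
    then show ?thesis using old z by blast
  next
    case False
    with R obtain v where v: "v \<in> F" "v \<notin> R" by blast
    then have v\<Delta>: "v \<in> \<Union>\<Delta>" using \<Delta> by blast
    define b where "b = cone_chain v ?N z"
    have b: "b \<in> simplicial_chains \<Delta> (i + 1)"
      unfolding b_def by (rule cone_chain_in_chains[OF zc]) (use v \<Delta> in blast)
    define z' where "z' = (\<lambda>w. z w - simplicial_boundary \<Delta> b w)"
    have "simplicial_boundaries \<Delta> i \<subseteq> (simplicial_cycles \<Delta> i :: ('a list \<Rightarrow> 'k) set)"
      by (rule simplicial_boundaries_subset_cycles) (rule down\<Delta>)
    with b have bb: "simplicial_boundary \<Delta> b \<in> simplicial_cycles \<Delta> i"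
      unfolding simplicial_boundaries_def by blast
    then have z'c: "z' \<in> simplicial_chains \<Delta> i"
      using zc unfolding z'_def simplicial_cycles_def by (blast intro: simplicial_chains_diff)
    have z'0: "simplicial_boundary \<Delta> z' = (\<lambda>w. 0)"
      using z bb unfolding z'_def simplicial_boundary_diff simplicial_cycles_def by simp
    \<comment> \<open>Among the vertices that can be put in front of \<open>w\<close>, only
      \<open>v\<close> gives a simplex of the cone, and there the coefficient is \<open>z w\<close>.
      Subtracting the boundary thus cancels \<open>z\<close> on the new faces without
      \<open>v\<close>.\<close>
    have without: "z' w = 0" if "set w \<in> ?N" "v \<notin> set w" for w
    proof -
      have "simplicial_boundary \<Delta> b w = (\<Sum>x\<in>\<Union>\<Delta>. if x = v then z w else 0)"
        unfolding simplicial_boundary_def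
      proof (rule sum.cong)
        fix x show "b (x # w) = (if x = v then z w else 0)"
          using that cone_chain_Cons[of v w ?N z] by (auto simp: b_def cone_chain_def)
      qed simp
      then show ?thesis using fin v\<Delta> by (simp add: z'_def)
    qed
    \<comment> \<open>For new faces containing \<open>v\<close>, the cycle condition at
      \<open>w\<close> without \<open>v\<close> is used. That smaller face is new because
      \<open>v\<close> is not in \<open>R\<close>, and so is every face obtained from it by adding
      another vertex \<open>x\<close>. Those avoid \<open>v\<close>, so only the summand for
      \<open>v\<close> is left and must vanish.\<close>
    have "z' w = 0" if w: "set w \<in> ?N" for w
    proof (rule ccontr)
      assume nz: "z' w \<noteq> 0"
      then have dist: "distinct w" using z'c unfolding simplicial_chains_def by blast
      have "v \<in> set w" using without w nz by blast
      then obtain p q where pq: "w = p @ v # q" by (meson split_list)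
      have N: "set (p @ q) \<in> ?N" using w pq dist v by auto
      have "z' (x # p @ q) = 0" if "x \<noteq> v" for x
      proof (rule ccontr)
        assume nz': "z' (x # p @ q) \<noteq> 0"
        then have "set (x # p @ q) \<in> \<Delta>" using z'c unfolding simplicial_chains_def by blast
        moreover have "set (p @ q) \<notin> \<Delta>'" using new N by blast
        then have "set (x # p @ q) \<notin> \<Delta>'"
          using down[of "set (x # p @ q)" "set (p @ q)"] by auto
        ultimately have "set (x # p @ q) \<in> ?N" by (rule new_faces)
        moreover have "v \<notin> set (x # p @ q)" using that dist pq by auto
        ultimately show False using without nz' by blast
      qed
      then have "simplicial_boundary \<Delta> z' (p @ q) = (\<Sum>x\<in>\<Union>\<Delta>. if x = v then z' (v # p @ q) else 0)"
        unfolding simplicial_boundary_def by (intro sum.cong) auto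
      then have "z' (v # p @ q) = 0" using z'0 fin v\<Delta> by simp
      then have "z' (p @ v # q) = 0"
        by (rule alternating_zero_move[rotated]) (rule simplicial_chains_swap[OF z'c])
      with nz pq show False by simp
    qed
    then have "z' \<in> simplicial_boundaries \<Delta> i"
      using z'c z'0 by (intro old) (auto simp: simplicial_cycles_def)
    then obtain b' where b': "b' \<in> simplicial_chains \<Delta> (i + 1)" "z' = simplicial_boundary \<Delta> b'"
      by (auto simp: simplicial_boundaries_def)
    have "z = simplicial_boundary \<Delta> (\<lambda>w. b' w + b w)"
      unfolding simplicial_boundary_add b'(2)[symmetric] by (simp add: z'_def)
    then show ?thesis
      unfolding simplicial_boundaries_def using simplicial_chains_add[OF b'(1) b] by blast
  qed
qed

text \<open>A shelling indexed by \<open>I\<close>: facets \<open>F c\<close> with restriction sets \<open>R c\<close>, where instead of a linear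
  order on the facets a strict partial order is given.\<close>

lemma shelling_homology_vanishes:
  fixes F R :: "'i \<Rightarrow> 'a set"
  assumes "finite I" and prec: "asymp_on I prec" "transp_on I prec"
    and fin: "\<And>c. c \<in> I \<Longrightarrow> finite (F c)"
    and card: "\<And>c. c \<in> I \<Longrightarrow> i + 1 < int (card (F c))"
    and R: "\<And>c. c \<in> I \<Longrightarrow> R c \<subseteq> F c"
    and earlier: "\<And>c v. c \<in> I \<Longrightarrow> v \<in> R c \<Longrightarrow> \<exists>c'\<in>I. prec c' c \<and> F c - {v} \<subseteq> F c'"
    and later: "\<And>c c'. c \<in> I \<Longrightarrow> c' \<in> I \<Longrightarrow> R c \<subseteq> F c' \<Longrightarrow> c' = c \<or> prec c c'"
  shows "reduced_homology_vanishes TYPE('k::comm_ring_1) (\<Union>c\<in>I. Pow (F c)) i"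
proof -
  let ?D = "\<lambda>J. \<Union>c\<in>J. Pow (F c)"
  \<comment> \<open>Sets \<open>J\<close> closed under \<open>prec\<close>-predecessors replace the
    initial segments of a linear shelling order.\<close>
  have "simplicial_cycles (?D J) i \<subseteq> (simplicial_boundaries (?D J) i :: ('a list \<Rightarrow> 'k) set)"
    if "finite J" "J \<subseteq> I" "\<And>c c'. c \<in> J \<Longrightarrow> c' \<in> I \<Longrightarrow> prec c' c \<Longrightarrow> c' \<in> J" for J
    using that
  proof (induction J rule: finite_remove_induct)
    case empty
    \<comment> \<open>Without facets even the empty face is missing, so there are no nonzero chains,
      not even in dimension \<open>-1\<close>. The first facet is thus added by the same argument as
      all others.\<close>
    have "c = (\<lambda>w. 0)" if "c \<in> simplicial_cycles {} i" for c :: "'a list \<Rightarrow> 'k"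
      using that simplicial_chains_support[of c "{}"] by (auto simp: simplicial_cycles_def)
    moreover have "(\<lambda>w. 0 :: 'k) \<in> simplicial_chains {} (i + 1)" by (simp add: simplicial_chains_def)
    then have "(\<lambda>w. 0 :: 'k) \<in> simplicial_boundaries {} i"
      unfolding simplicial_boundaries_def
      by (rule rev_image_eqI) (simp add: simplicial_boundary_def)
    ultimately show ?case by auto
  next
    case (remove J)
    have "asymp_on J prec" "transp_on J prec"
      using prec remove.prems(1) by (blast intro: asymp_on_subset transp_on_subset)+
    then obtain c where c: "c \<in> J" "\<And>c'. c' \<in> J \<Longrightarrow> c' \<noteq> c \<Longrightarrow> \<not> prec c c'"
      using Finite_Set.bex_max_element[OF remove.hyps(1)] remove.hyps(2) by blast
    then have cI: "c \<in> I" using remove.prems by blast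
    let ?J = "J - {c}"
    have IH: "simplicial_cycles (?D ?J) i \<subseteq> (simplicial_boundaries (?D ?J) i :: ('a list \<Rightarrow> 'k) set)"
      using c remove.prems by (intro remove.IH[of c]) blast+
    \<comment> \<open>A face missing a vertex of \<open>R c\<close> lies, by \<open>earlier\<close>,
      on a preceding facet, which belongs to \<open>J\<close>. Conversely, another facet of
      \<open>J\<close> containing \<open>R c\<close> would come after \<open>c\<close> by
      \<open>later\<close>, against the maximality of \<open>c\<close>.\<close>
    have new: "G \<notin> ?D ?J \<longleftrightarrow> R c \<subseteq> G" if G: "G \<subseteq> F c" for G
    proof
      assume *: "G \<notin> ?D ?J"
      show "R c \<subseteq> G"
      proof (rule ccontr)
        assume "\<not> R c \<subseteq> G"
        then obtain v where v: "v \<in> R c" "v \<notin> G" by blast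
        from earlier[OF cI v(1)] obtain c' where c': "c' \<in> I" "prec c' c" "F c - {v} \<subseteq> F c'" by blast
        then have "c' \<in> J" using remove.prems c by blast
        moreover have "c' \<noteq> c" using c' prec(1) cI by (auto dest: asymp_onD)
        ultimately show False using * G v c' by blast
      qed
    next
      assume RG: "R c \<subseteq> G"
      show "G \<notin> ?D ?J"
      proof
        assume "G \<in> ?D ?J"
        then obtain c' where c': "c' \<in> J" "c' \<noteq> c" "G \<subseteq> F c'" by blast
        then have "c' \<in> I" "R c \<subseteq> F c'" using RG remove.prems(1) by blast+
        then show False using later[OF cI] c(2) c' by blast
      qed
    qed
    show ?case
    proof (rule cycles_subset_boundaries_insert_facet[OF _ _ _ new R[OF cI] card[OF cI] IH])
      show "?D J = ?D ?J \<union> Pow (F c)" using c(1) by blast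
      have "finite (\<Union>c\<in>J. F c)" using remove.hyps(1) remove.prems(1) fin by blast
      then show "finite (\<Union>(?D J))" by (rule rev_finite_subset) blast
      show "H \<in> ?D ?J" if "G \<in> ?D ?J" "H \<subseteq> G" for G H using that by blast
    qed
  qed
  from this[of I] assms(1)
  have "simplicial_cycles (?D I) i \<subseteq> (simplicial_boundaries (?D I) i :: ('a list \<Rightarrow> 'k) set)" by blast
  moreover have "(simplicial_boundaries (?D I) i :: ('a list \<Rightarrow> 'k) set) \<subseteq> simplicial_cycles (?D I) i"
    by (rule simplicial_boundaries_subset_cycles) blast
  ultimately show ?thesis unfolding reduced_homology_vanishes_def by (rule equalityI)
qed

text \<open>The link of \<open>H\<close> is shelled by the facets \<open>F c - H\<close> with
  \<open>H \<subseteq> F c\<close>, the restriction sets \<open>R c - H\<close> and the same order: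
  a vertex removed in \<open>earlier\<close> lies outside \<open>H\<close>, so the preceding facet
  still contains \<open>H\<close>. As all facets have \<open>d\<close> elements, each facet of the
  link has the full dimension of the link.\<close>

lemma shelling_cohen_macaulay:
  fixes F R :: "'i \<Rightarrow> 'a set"
  assumes "finite I" and prec: "asymp_on I prec" "transp_on I prec"
    and fin: "\<And>c. c \<in> I \<Longrightarrow> finite (F c)"
    and card: "\<And>c. c \<in> I \<Longrightarrow> card (F c) = d"
    and R: "\<And>c. c \<in> I \<Longrightarrow> R c \<subseteq> F c"
    and earlier: "\<And>c v. c \<in> I \<Longrightarrow> v \<in> R c \<Longrightarrow> \<exists>c'\<in>I. prec c' c \<and> F c - {v} \<subseteq> F c'"
    and later: "\<And>c c'. c \<in> I \<Longrightarrow> c' \<in> I \<Longrightarrow> R c \<subseteq> F c' \<Longrightarrow> c' = c \<or> prec c c'"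
  shows "cohen_macaulay_complex TYPE('k::comm_ring_1) (\<Union>c\<in>I. Pow (F c))"
  unfolding cohen_macaulay_complex_def
proof (intro ballI allI impI)
  fix H i
  let ?L = "link (\<Union>c\<in>I. Pow (F c)) H"
  assume H: "H \<in> (\<Union>c\<in>I. Pow (F c))" and i: "i < complex_dim ?L"
  let ?I = "{c \<in> I. H \<subseteq> F c}"
  have L: "?L = (\<Union>c\<in>?I. Pow (F c - H))"
  proof (intro equalityI subsetI)
    fix G assume "G \<in> ?L"
    then have "H \<inter> G = {}" "H \<union> G \<in> (\<Union>c\<in>I. Pow (F c))" by (simp_all add: link_def)
    then show "G \<in> (\<Union>c\<in>?I. Pow (F c - H))" by auto
  next
    fix G assume "G \<in> (\<Union>c\<in>?I. Pow (F c - H))"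
    then obtain c where "c \<in> I" "H \<subseteq> F c" "G \<subseteq> F c - H" by blast
    then have "G \<subseteq> F c" "H \<inter> G = {}" "H \<union> G \<subseteq> F c" by blast+
    with \<open>c \<in> I\<close> show "G \<in> ?L" unfolding link_def by blast
  qed
  have cardL: "card (F c - H) = d - card H" if "c \<in> ?I" for c
    using that fin card by (auto simp: card_Diff_subset finite_subset)
  have "Max (card ` ?L) = d - card H"
  proof (rule Max_eqI)
    show "finite (card ` ?L)" unfolding L using fin assms(1) by auto
    show "k \<le> d - card H" if k: "k \<in> card ` ?L" for k
    proof -
      obtain c G where c: "c \<in> ?I" "G \<subseteq> F c - H" "k = card G" using k unfolding L by blast
      then show ?thesis using card_mono[OF finite_Diff[OF fin] c(2)] cardL[OF c(1)] by simp
    qed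
    obtain c where "c \<in> ?I" using H by blast
    then have "F c - H \<in> ?L" unfolding L by blast
    then show "d - card H \<in> card ` ?L" using cardL[OF \<open>c \<in> ?I\<close>] by (metis imageI)
  qed
  then have dim: "complex_dim ?L = int (d - card H) - 1" by (simp add: complex_dim_def)
  have "reduced_homology_vanishes TYPE('k) (\<Union>c\<in>?I. Pow (F c - H)) i"
  proof (rule shelling_homology_vanishes[where prec = prec and R = "\<lambda>c. R c - H"])
    show "asymp_on ?I prec" "transp_on ?I prec"
      using prec by (blast intro: asymp_on_subset transp_on_subset)+
    show "i + 1 < int (card (F c - H))" if "c \<in> ?I" for c using cardL[OF that] i dim by simp
    show "R c - H \<subseteq> F c - H" if "c \<in> ?I" for c using that R by blast
    show "\<exists>c'\<in>?I. prec c' c \<and> F c - H - {v} \<subseteq> F c' - H" if "c \<in> ?I" "v \<in> R c - H" for c v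
    proof -
      from earlier[of c v] that obtain c' where "c' \<in> I" "prec c' c" "F c - {v} \<subseteq> F c'" by blast
      moreover from this that have "H \<subseteq> F c'" by blast
      ultimately show ?thesis by blast
    qed
    show "c' = c \<or> prec c c'" if "c \<in> ?I" "c' \<in> ?I" "R c - H \<subseteq> F c' - H" for c c'
      using that later[of c c'] by blast
  qed (use assms(1) fin in auto)
  then show "reduced_homology_vanishes TYPE('k) ?L i" unfolding L .
qed

section \<open>Graded posets with an EL-labeling are Cohen--Macaulay\<close>

text \<open>Incomparable consecutive labels count as descents too. The ends of a maximal chain never
  belong to this set.\<close>

definition descents :: "'l rel \<Rightarrow> ('a \<Rightarrow> 'a \<Rightarrow> 'l) \<Rightarrow> 'a list \<Rightarrow> 'a set" where
  "descents s lab c = {v. \<exists>p a b q. c = p @ a # v # b # q \<and> (lab a v, lab v b) \<notin> s - Id}"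

text \<open>In a maximal chain, the prefix ending at the first descent is the increasing chain of
  its interval, so the lexicographic minimality in the EL-labeling applies to it.\<close>

lemma first_descent:
  assumes "\<not> increasing_chain s lab c"
  obtains p a v b q where "c = p @ a # v # b # q" "increasing_chain s lab (p @ [a, v])"
    "(lab a v, lab v b) \<notin> s - Id"
  using assms
proof (induction c arbitrary: thesis)
  case Nil
  then show ?case by (simp add: increasing_chain_def chain_labels_def)
next
  case (Cons x c)
  obtain y z d where c: "c = y # z # d"
    using Cons.prems(2)
    by (cases c; cases "tl c") (auto simp: increasing_chain_def)
  show ?case
  proof (cases "(lab x y, lab y z) \<in> s - Id")
    case False
    then show ?thesis using Cons.prems(1)[of "[]" x y z d] c
      by (simp add: increasing_chain_def)
  next
    case True
    then have "\<not> increasing_chain s lab c"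
      using Cons.prems(2) c by (auto simp: increasing_chain_def)
    then obtain p a v b q where *: "c = p @ a # v # b # q" "increasing_chain s lab (p @ [a, v])"
      "(lab a v, lab v b) \<notin> s - Id" using Cons.IH by blast
    have "increasing_chain s lab ((x # p) @ [a, v])"
      using * c True by (cases p; cases "tl p") (auto simp: increasing_chain_def)
    then show ?thesis using Cons.prems(1)[of "x # p" a v b q] * by simp
  qed
qed

text \<open>The rank has integer values so that minus the number of blocks can serve as one.\<close>

lemma length_maximal_chain:
  assumes "\<And>x y. covers r x y \<Longrightarrow> rank y = rank x + (1 :: int)" "maximal_chain r x y c"
  shows "int (length c) = rank y - rank x + 1"
  using assms(2)
proof (induction c arbitrary: x)
  case (Cons a c)
  show ?case
  proof (cases "c = []")
    case False
    with Cons.prems have "covers r x (hd c)" "maximal_chain r (hd c) y c"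
      by (auto simp: maximal_chain_Cons)
    with Cons.IH assms(1) show ?thesis by force
  qed (use Cons.prems in \<open>auto simp: maximal_chain_def\<close>)
qed (simp add: maximal_chain_def)

lemma maximal_chain_total:
  assumes "Partial_order r" "maximal_chain r x y c" "x \<in> Field r" "a \<in> set c" "b \<in> set c"
  shows "(a, b) \<in> r \<or> (b, a) \<in> r"
proof -
  obtain p q where c: "c = p @ a # q" using assms(4) by (meson split_list)
  have a: "a \<in> Field r"
    using maximal_chain_le[OF assms(1-4)] by (auto simp: Field_def)
  have "maximal_chain r x a (p @ [a])" "maximal_chain r a y (a # q)"
    using maximal_chain_split assms(2) c by metis+
  moreover have "b \<in> set (p @ [a]) \<or> b \<in> set (a # q)" using assms(5) c by auto
  ultimately show ?thesis
    using maximal_chain_le[OF assms(1)] assms(3) a by meson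
qed

lemma EL_labeling_chain_exists:
  assumes "EL_labeling r s lab" "(x, y) \<in> r"
  obtains c where "maximal_chain r x y c" "increasing_chain s lab c"
  using assms unfolding EL_labeling_def by blast

lemma EL_labeling_precedes:
  assumes "EL_labeling r s lab" "(x, y) \<in> r" "maximal_chain r x y c" "increasing_chain s lab c"
    "maximal_chain r x y d" "d \<noteq> c"
  shows "(chain_labels lab c, chain_labels lab d) \<in> lexord (s - Id)"
  using assms unfolding EL_labeling_def by blast

text \<open>An EL-labeling provides a maximal chain in every interval; such chains are glued at the
  elements of \<open>G\<close>, starting from its least one. This identifies the facets of the order
  complex.\<close>

lemma EL_labeling_extend_chain:
  assumes EL: "EL_labeling r s lab" and "finite G" "(x, y) \<in> r" "G \<in> Chains r"
    "\<And>g. g \<in> G \<Longrightarrow> (x, g) \<in> r \<and> (g, y) \<in> r"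
  obtains c where "maximal_chain r x y c" "G \<subseteq> set c"
proof -
  have po: "antisym r" "trans r"
    using EL by (auto simp: EL_labeling_def finite_poset_def order_on_defs)
  have "\<exists>c. maximal_chain r x y c \<and> G \<subseteq> set c"
    using assms(2-5)
  proof (induction G arbitrary: x rule: finite_remove_induct)
    case empty
    then show ?case using EL_labeling_chain_exists[OF EL] by (metis empty_subsetI)
  next
    case (remove G)
    have "asymp_on G (\<lambda>a b. (a, b) \<in> r - Id)" "transp_on G (\<lambda>a b. (a, b) \<in> r - Id)"
      using po by (auto simp: asymp_on_def transp_on_def dest: antisymD transD)
    then obtain g where g: "g \<in> G" "\<And>h. h \<in> G \<Longrightarrow> h \<noteq> g \<Longrightarrow> (h, g) \<notin> r"
      using Finite_Set.bex_min_element[OF remove.hyps(1)] remove.hyps(2) by blast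
    have gh: "(g, h) \<in> r" if "h \<in> G" for h
      using g that remove.prems(2) unfolding Chains_def by blast
    have "\<exists>c. maximal_chain r g y c \<and> G - {g} \<subseteq> set c"
    proof (rule remove.IH)
      show "G - {g} \<in> Chains r" using remove.prems(2) unfolding Chains_def by blast
    qed (use g gh remove.prems in auto)
    then obtain d where d: "maximal_chain r g y d" "G - {g} \<subseteq> set d" by blast
    then obtain d' where d': "d = g # d'" by (cases d) (auto simp: maximal_chain_def)
    obtain c where c: "maximal_chain r x g c"
      using EL_labeling_chain_exists[OF EL] remove.prems(3) g(1) by metis
    then have "c = butlast c @ [g]" by (auto simp: maximal_chain_def)
    with c d d' have "maximal_chain r x y (butlast c @ d)" by (metis maximal_chain_append)
    moreover have "G \<subseteq> set (butlast c @ d)" using d d' by auto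
    ultimately show ?case by blast
  qed
  then show ?thesis using that by blast
qed

text \<open>Replace the segment \<open>a\<close>, \<open>v\<close>, \<open>b\<close> by the
  increasing chain of \<open>[a, b]\<close>. By the grading that chain also has a single inner
  element, so at most \<open>v\<close> is lost and the label lists first differ inside the
  segment.\<close>

lemma descent_imp_earlier_chain:
  assumes EL: "EL_labeling r s lab"
    and graded: "\<And>x y. covers r x y \<Longrightarrow> rank y = rank x + (1 :: int)"
    and c: "maximal_chain r x y c" and v: "v \<in> descents s lab c"
  obtains c' where "maximal_chain r x y c'"
    "(chain_labels lab c', chain_labels lab c) \<in> lexord (s - Id)" "set c - {v} \<subseteq> set c'"
proof -
  have po: "Partial_order r" using EL by (auto simp: EL_labeling_def finite_poset_def)
  obtain p a b q where c_eq: "c = p @ a # v # b # q" and desc: "(lab a v, lab v b) \<notin> s - Id"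
    using v unfolding descents_def by blast
  have xa: "maximal_chain r x a (p @ [a])" and ay: "maximal_chain r a y ([a, v] @ b # q)"
    using maximal_chain_split[of r x y p a "v # b # q"] c c_eq by auto
  have ab: "maximal_chain r a b [a, v, b]" and b_y: "maximal_chain r b y (b # q)"
    using maximal_chain_split[OF ay] by auto
  have "a \<in> Field r" using ab by (auto simp: maximal_chain_def covers_def Field_def)
  then have "(a, b) \<in> r" using maximal_chain_le[OF po ab, of b] by simp
  then obtain d where d: "maximal_chain r a b d" "increasing_chain s lab d"
    using EL_labeling_chain_exists[OF EL] by blast
  have "\<not> increasing_chain s lab [a, v, b]" using desc by (simp add: increasing_chain_def)
  then have ne: "[a, v, b] \<noteq> d" using d by blast
  have lex: "(chain_labels lab d, chain_labels lab [a, v, b]) \<in> lexord (s - Id)"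
    by (rule EL_labeling_precedes[OF EL \<open>(a, b) \<in> r\<close> d ab ne])
  have "int (length d) = int (length [a, v, b])"
    using length_maximal_chain[where rank = rank, OF graded] d(1) ab by metis
  then obtain w where w: "d = [a, w, b]"
    using d(1) by (auto simp: maximal_chain_def eval_nat_numeral length_Suc_conv)
  have "maximal_chain r a y ([a, w] @ b # q)"
    using b_y by (rule maximal_chain_append[rotated]) (use d(1) w in simp)
  then have "maximal_chain r x y (p @ a # w # b # q)"
    using maximal_chain_append[OF xa, of y "w # b # q"] by simp
  moreover have "(chain_labels lab (p @ a # w # b # q), chain_labels lab c) \<in> lexord (s - Id)"
    unfolding c_eq chain_labels_append[of lab p a "w # b # q"] chain_labels_append[of lab p a "v # b # q"]
    using lex w by (intro lexord_append_leftI) auto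
  moreover have "set c - {v} \<subseteq> set (p @ a # w # b # q)" using c_eq by auto
  ultimately show ?thesis using that by blast
qed

text \<open>The first descent \<open>v\<close> of \<open>c\<close> lies on \<open>d\<close>. Up to
  \<open>v\<close> the chain \<open>c\<close> is increasing, so either \<open>d\<close> is already
  later there, or both agree up to \<open>v\<close> and induction treats the rest, whose descents
  are descents of \<open>c\<close>.\<close>

lemma descents_subset_imp_later_chain:
  assumes EL: "EL_labeling r s lab"
    and graded: "\<And>x y. covers r x y \<Longrightarrow> rank y = rank x + (1 :: int)"
    and "x \<in> Field r" "maximal_chain r x y c" "maximal_chain r x y d" "descents s lab c \<subseteq> set d"
  shows "d = c \<or> (chain_labels lab c, chain_labels lab d) \<in> lexord (s - Id)"
  using assms(3-6)
proof (induction "length c" arbitrary: x c d rule: less_induct)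
  case less
  have po: "Partial_order r" using EL by (auto simp: EL_labeling_def finite_poset_def)
  have last: "y \<in> set c" using less.prems(2) by (auto simp: maximal_chain_def)
  have xy: "(x, y) \<in> r" using maximal_chain_le[OF po less.prems(2,1) last] by blast
  show ?case
  proof (cases "increasing_chain s lab c")
    case True
    then show ?thesis using EL_labeling_precedes[OF EL xy less.prems(2) _ less.prems(3)] by blast
  next
    case False
    then obtain p a v b q where c: "c = p @ a # v # b # q" "increasing_chain s lab (p @ [a, v])"
      "(lab a v, lab v b) \<notin> s - Id" by (rule first_descent)
    define p' where "p' = p @ [a]"
    have c': "c = p' @ v # b # q" by (simp add: c p'_def)
    have "v \<in> set d" using c less.prems(4) unfolding descents_def by blast
    then obtain d1 d2 where d: "d = d1 @ v # d2" by (meson split_list)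
    have cs: "maximal_chain r x v (p' @ [v])" "maximal_chain r v y (v # b # q)"
      using maximal_chain_split less.prems(2) unfolding c' by metis+
    have ds: "maximal_chain r x v (d1 @ [v])" "maximal_chain r v y (v # d2)"
      using maximal_chain_split less.prems(3) unfolding d by metis+
    have xv: "(x, v) \<in> r" using maximal_chain_le[OF po cs(1) less.prems(1), of v] by simp
    have inc: "increasing_chain s lab (p' @ [v])" using c(2) by (simp add: p'_def)
    \<comment> \<open>With unequal lengths one label list could be a proper prefix of the other, and
      the labels above \<open>v\<close> would decide the comparison.\<close>
    have len: "length (p' @ [v]) = length (d1 @ [v])"
      using length_maximal_chain[where rank = rank, OF graded cs(1)] length_maximal_chain[where rank = rank, OF graded ds(1)] by simp
    show ?thesis
    proof (cases "d1 = p'")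
      case False
      then have "(chain_labels lab (p' @ [v]), chain_labels lab (d1 @ [v])) \<in> lexord (s - Id)"
        using EL_labeling_precedes[OF EL xv cs(1) inc ds(1)] by simp
      then have "(chain_labels lab c, chain_labels lab d) \<in> lexord (s - Id)"
        unfolding c' d chain_labels_append[of lab p' v "b # q"] chain_labels_append[of lab d1 v d2]
        using len by (intro lexord_sufI) simp_all
      then show ?thesis ..
    next
      case True
      have "descents s lab (v # b # q) \<subseteq> set (v # d2)"
      proof
        fix u assume u: "u \<in> descents s lab (v # b # q)"
        then obtain p1 a1 b1 q1 where e: "v # b # q = p1 @ a1 # u # b1 # q1"
          "(lab a1 u, lab u b1) \<notin> s - Id" unfolding descents_def by blast
        then have "c = (p' @ p1) @ a1 # u # b1 # q1" using c' by simp
        then have "u \<in> descents s lab c" unfolding descents_def using e(2) by blast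
        then have "u \<in> set d" using less.prems(4) by blast
        moreover have "u \<in> set (v # b # q)" using e(1) by simp
        then have "u \<notin> set p'"
          using distinct_maximal_chain[OF po less.prems(2)] unfolding c' by auto
        ultimately show "u \<in> set (v # d2)" using d True by auto
      qed
      moreover have "v \<in> Field r" using xv by (auto simp: Field_def)
      moreover have "length (v # b # q) < length c" using c by simp
      ultimately have "v # d2 = v # b # q \<or>
        (chain_labels lab (v # b # q), chain_labels lab (v # d2)) \<in> lexord (s - Id)"
        using less.hyps cs(2) ds(2) by blast
      then show ?thesis
        using True lexord_append_leftI
        unfolding c' d chain_labels_append[of lab p' v "b # q"] chain_labels_append[of lab d1 v d2]
        by blast
    qed
  qed
qed

theorem graded_EL_labeling_cohen_macaulay:
  assumes EL: "EL_labeling r s lab"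
    and graded: "\<And>x y. covers r x y \<Longrightarrow> rank y = rank x + (1 :: int)"
    and xy: "(x, y) \<in> r"
  shows "cohen_macaulay_poset TYPE('k::comm_ring_1) (closed_interval r x y)"
proof -
  have po: "Partial_order r" and fin: "finite (Field r)" and s: "Partial_order s"
    using EL by (auto simp: EL_labeling_def finite_poset_def)
  have xF: "x \<in> Field r" using xy by (auto simp: Field_def)
  let ?I = "{c. maximal_chain r x y c}"
  let ?A = "{z. (x, z) \<in> r \<and> (z, y) \<in> r}"
  have setc: "set c \<subseteq> ?A" if "c \<in> ?I" for c
    using maximal_chain_le[OF po _ xF] that by blast
  have "?A \<subseteq> Field r" by (auto simp: Field_def)
  then have "finite ?A" using fin finite_subset by blast
  then have "finite {c. set c \<subseteq> ?A \<and> distinct c}" by (rule finite_subset_distinct)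
  moreover have "?I \<subseteq> {c. set c \<subseteq> ?A \<and> distinct c}"
    using setc distinct_maximal_chain[OF po] by blast
  ultimately have finI: "finite ?I" by (rule rev_finite_subset)
  have complex: "order_complex (closed_interval r x y) = (\<Union>c\<in>?I. Pow (set c))"
  proof (intro equalityI subsetI)
    fix G assume "G \<in> order_complex (closed_interval r x y)"
    then have G: "finite G" "\<And>a b. a \<in> G \<Longrightarrow> b \<in> G \<Longrightarrow> (a, b) \<in> Restr r ?A \<or> (b, a) \<in> Restr r ?A"
      unfolding order_complex_def Chains_def closed_interval_def by blast+
    then have "G \<in> Chains r" "\<And>g. g \<in> G \<Longrightarrow> (x, g) \<in> r \<and> (g, y) \<in> r"
      unfolding Chains_def by blast+
    then obtain c where "maximal_chain r x y c" "G \<subseteq> set c"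
      using EL_labeling_extend_chain[OF EL G(1) xy] by blast
    then show "G \<in> (\<Union>c\<in>?I. Pow (set c))" by blast
  next
    fix G assume "G \<in> (\<Union>c\<in>?I. Pow (set c))"
    then obtain c where c: "maximal_chain r x y c" "G \<subseteq> set c" by blast
    then have "finite G" by (simp add: finite_subset)
    moreover have "(a, b) \<in> Restr r ?A \<or> (b, a) \<in> Restr r ?A" if "a \<in> G" "b \<in> G" for a b
      using maximal_chain_total[OF po c(1) xF, of a b] setc[of c] c that by blast
    ultimately show "G \<in> order_complex (closed_interval r x y)"
      unfolding order_complex_def Chains_def closed_interval_def by blast
  qed
  \<comment> \<open>This is not a linear order: chains whose labels are incomparable at the first
    difference are unrelated.\<close>
  let ?prec = "\<lambda>c d. (chain_labels lab c, chain_labels lab d) \<in> lexord (s - Id)"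
  have "cohen_macaulay_complex TYPE('k) (\<Union>c\<in>?I. Pow (set c))"
  proof (rule shelling_cohen_macaulay[where prec = ?prec and R = "descents s lab"])
    show "transp_on ?I ?prec"
      by (rule transp_onI) (use trans_lexord_strict[OF s] in \<open>blast dest: transD\<close>)
    show "asymp_on ?I ?prec"
      by (rule asymp_onI)
        (use trans_lexord_strict[OF s] irrefl_lexord_strict in \<open>blast dest: transD\<close>)
    show "card (set c) = nat (rank y - rank x + 1)" if "c \<in> ?I" for c
      using that length_maximal_chain[where rank = rank, OF graded] distinct_card[OF distinct_maximal_chain[OF po]]
      by (metis mem_Collect_eq nat_int)
    show "descents s lab c \<subseteq> set c" for c by (auto simp: descents_def)
    show "\<exists>c'\<in>?I. ?prec c' c \<and> set c - {v} \<subseteq> set c'" if "c \<in> ?I" "v \<in> descents s lab c" for c v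
      using descent_imp_earlier_chain[where rank = rank, OF EL graded _ that(2)] that(1) by blast
    show "d = c \<or> ?prec c d" if "c \<in> ?I" "d \<in> ?I" "descents s lab c \<subseteq> set d" for c d
      using descents_subset_imp_later_chain[where rank = rank, OF EL graded xF] that by blast
  qed (use finI in auto)
  moreover have "finite_poset (closed_interval r x y)"
    unfolding finite_poset_def closed_interval_def
    using Partial_order_Restr[OF po] finite_subset[OF mono_Field[of "Restr r ?A" r] fin] by blast
  ultimately show ?thesis by (simp add: cohen_macaulay_poset_def complex)
qed

section \<open>Pointed partitions\<close>

lemma pointed_partitionsI:
  assumes "\<And>A p. (A, p) \<in> x \<Longrightarrow> A \<subseteq> {1..n} \<and> p \<in> A"
    and "\<And>A p B q i. (A, p) \<in> x \<Longrightarrow> (B, q) \<in> x \<Longrightarrow> i \<in> A \<Longrightarrow> i \<in> B \<Longrightarrow> A = B \<and> p = q"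
    and "\<And>i. i \<in> {1..n} \<Longrightarrow> \<exists>A p. (A, p) \<in> x \<and> i \<in> A"
  shows "x \<in> pointed_partitions n"
proof -
  have "partition_on {1..n} (fst ` x)"
  proof (rule partition_onI)
    have "\<Union>(fst ` x) \<subseteq> {1..n}" using assms(1) by fastforce
    moreover have "{1..n} \<subseteq> \<Union>(fst ` x)" using assms(3) by force
    ultimately show "\<Union>(fst ` x) = {1..n}" by blast
    show "disjnt P Q" if "P \<in> fst ` x" "Q \<in> fst ` x" "P \<noteq> Q" for P Q
      using that assms(2) unfolding disjnt_iff by fastforce
    show "{} \<notin> fst ` x" using assms(1) by fastforce
  qed
  moreover have "inj_on fst x" using assms(1,2) by (intro inj_onI) force
  ultimately show ?thesis unfolding pointed_partitions_def using assms(1) by blast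
qed

lemma pointed_partition_block:
  assumes "x \<in> pointed_partitions n" "(A, p) \<in> x"
  shows "A \<subseteq> {1..n}" "finite A" "p \<in> A" "Min A \<in> A"
proof -
  have "A \<in> fst ` x" using assms(2) by force
  then show A: "A \<subseteq> {1..n}" using assms(1) by (auto simp: pointed_partitions_def partition_on_def)
  show p: "p \<in> A" using assms by (auto simp: pointed_partitions_def)
  show fin: "finite A" by (rule finite_subset[OF A]) simp
  show "Min A \<in> A" by (rule Min_in) (use p fin in auto)
qed

lemma pointed_partition_unique:
  assumes "x \<in> pointed_partitions n" "(A, p) \<in> x" "(B, q) \<in> x" "i \<in> A" "i \<in> B"
  shows "A = B" "p = q"
proof -
  have part: "partition_on {1..n} (fst ` x)" and inj: "inj_on fst x"
    using assms(1) by (auto simp: pointed_partitions_def)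
  have "A \<in> fst ` x" "B \<in> fst ` x" using assms(2,3) by force+
  then show "A = B" using partition_onD2[OF part] assms(4,5) unfolding disjoint_def by blast
  then have "(A, p) = (B, q)" by (intro inj_onD[OF inj _ assms(2,3)]) simp
  then show "p = q" by simp
qed

lemma pointed_partition_cover:
  assumes "x \<in> pointed_partitions n" "i \<in> {1..n}"
  obtains A p where "(A, p) \<in> x" "i \<in> A"
proof -
  have "i \<in> \<Union>(fst ` x)"
    using assms partition_onD1 unfolding pointed_partitions_def by blast
  then show ?thesis using that by force
qed

lemma finite_pointed_partitions: "finite (pointed_partitions n)"
proof (rule finite_subset)
  show "pointed_partitions n \<subseteq> Pow (Pow {1..n} \<times> {1..n})"
  proof clarify
    fix x A p assume "x \<in> pointed_partitions n" "(A, p) \<in> x"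
    from pointed_partition_block[OF this]
    show "A \<in> Pow {1..n} \<and> p \<in> {1..n}" by blast
  qed
qed simp

lemma finite_pointed_partition:
  assumes "x \<in> pointed_partitions n" shows "finite x"
proof (rule finite_subset)
  show "x \<subseteq> Pow {1..n} \<times> {1..n}"
  proof clarify
    fix A p assume "(A, p) \<in> x"
    from pointed_partition_block[OF assms this]
    show "A \<in> Pow {1..n} \<and> p \<in> {1..n}" by blast
  qed
qed simp

text \<open>The condition on pointers is global, yet for pointed partitions it is local: if the
  pointer \<open>r\<close> of a block \<open>C\<close> of \<open>y\<close> is the pointer of a block
  of \<open>x\<close>, then that block contains \<open>r\<close> and hence lies in
  \<open>C\<close>.\<close>

definition pointed_refines :: "pointed_partition \<Rightarrow> pointed_partition \<Rightarrow> bool" where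
  "pointed_refines x y \<longleftrightarrow> (\<forall>A p. (A, p) \<in> x \<longrightarrow> (\<exists>C r. (C, r) \<in> y \<and> A \<subseteq> C)) \<and> snd ` y \<subseteq> snd ` x"

lemma pointed_refines_refl: "pointed_refines x x"
  unfolding pointed_refines_def by blast

lemma pointed_refines_trans: "pointed_refines x y \<Longrightarrow> pointed_refines y z \<Longrightarrow> pointed_refines x z"
  unfolding pointed_refines_def by (meson subset_trans)

lemma pointed_refines_subset:
  assumes "pointed_refines x y" "y \<in> pointed_partitions n" "(A, p) \<in> x" "(C, r) \<in> y" "i \<in> A" "i \<in> C"
  shows "A \<subseteq> C"
proof -
  obtain C' r' where "(C', r') \<in> y" "A \<subseteq> C'" using assms(1,3) unfolding pointed_refines_def by blast
  with pointed_partition_unique[OF assms(2,4) this(1)] assms(5,6) show ?thesis by blast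
qed

section \<open>The effect of a single merge\<close>

lemma pointed_mergeE:
  assumes "pointed_merge (a, b, u) x z"
  obtains A p B q s where "(A, p) \<in> x" "(B, q) \<in> x" "Min A = a" "Min B = b" "Min A < Min B"
    "u = 1 \<and> s = p \<or> u = 0 \<and> s = q" "z = insert (A \<union> B, s) (x - {(A, p), (B, q)})"
  using assms by auto

text \<open>A block determines its pointer, so deleting the two pairs amounts to excluding the two
  blocks; membership in a merged partition is used in this form.\<close>

lemma pointed_partition_two_blocks:
  assumes x: "x \<in> pointed_partitions n" and AB: "(A, p) \<in> x" "(B, q) \<in> x" "Min A < Min B"
  shows "A \<inter> B = {}" "p \<noteq> q" "Min (A \<union> B) = Min A" "(A \<union> B, s) \<notin> x"
    "(E, e) \<in> insert (A \<union> B, s) (x - {(A, p), (B, q)}) \<longleftrightarrow>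
       E = A \<union> B \<and> e = s \<or> (E, e) \<in> x \<and> E \<noteq> A \<and> E \<noteq> B"
proof -
  note blA = pointed_partition_block[OF x AB(1)] and blB = pointed_partition_block[OF x AB(2)]
  show disj: "A \<inter> B = {}" using pointed_partition_unique(1)[OF x AB(1,2)] AB(3) by auto
  then show "p \<noteq> q" using blA blB by blast
  have "Min (A \<union> B) = min (Min A) (Min B)" by (rule Min_Un) (use blA blB in auto)
  then show "Min (A \<union> B) = Min A" using AB by simp
  show "(A \<union> B, s) \<notin> x"
  proof
    assume "(A \<union> B, s) \<in> x"
    from pointed_partition_unique(1)[OF x AB(1) this blA(3)] blA(3) disj blB(3) show False
      by blast
  qed
  have "e = p" if "(A, e) \<in> x" using pointed_partition_unique(2)[OF x that AB(1)] blA(3) by blast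
  moreover have "e = q" if "(B, e) \<in> x" using pointed_partition_unique(2)[OF x that AB(2)] blB(3) by blast
  ultimately show "(E, e) \<in> insert (A \<union> B, s) (x - {(A, p), (B, q)}) \<longleftrightarrow>
       E = A \<union> B \<and> e = s \<or> (E, e) \<in> x \<and> E \<noteq> A \<and> E \<noteq> B" by blast
qed

lemma pointed_merge_card:
  assumes "pointed_merge l x z" "x \<in> pointed_partitions n"
  shows "card x = Suc (card z)"
proof -
  obtain a b u where l: "l = (a, b, u)" by (cases l)
  obtain A p B q s where AB: "(A, p) \<in> x" "(B, q) \<in> x" "Min A = a" "Min B = b" "Min A < Min B"
    and s: "u = 1 \<and> s = p \<or> u = 0 \<and> s = q" and z: "z = insert (A \<union> B, s) (x - {(A, p), (B, q)})"
    by (rule pointed_mergeE[OF assms(1)[unfolded l]])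
  note two = pointed_partition_two_blocks[OF assms(2) AB(1,2,5)]
  have fin: "finite x" by (rule finite_pointed_partition[OF assms(2)])
  have "{(A, p), (B, q)} \<subseteq> x" "card {(A, p), (B, q)} = 2" using AB two(2) by auto
  with fin have "card (x - {(A, p), (B, q)}) = card x - 2" "2 \<le> card x"
    using card_mono[of x "{(A, p), (B, q)}"] by (auto simp: card_Diff_subset)
  then show ?thesis using z two(4)[of s] fin by simp
qed

lemma pointed_merge_in_pointed_partitions:
  assumes "pointed_merge l x z" "x \<in> pointed_partitions n"
  shows "z \<in> pointed_partitions n"
proof -
  obtain a b u where l: "l = (a, b, u)" by (cases l)
  obtain A p B q s where AB: "(A, p) \<in> x" "(B, q) \<in> x" "Min A = a" "Min B = b" "Min A < Min B"
    and s: "u = 1 \<and> s = p \<or> u = 0 \<and> s = q" and z: "z = insert (A \<union> B, s) (x - {(A, p), (B, q)})"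
    by (rule pointed_mergeE[OF assms(1)[unfolded l]])
  note two = pointed_partition_two_blocks[OF assms(2) AB(1,2,5)]
  have z_iff: "(E, e) \<in> z \<longleftrightarrow> E = A \<union> B \<and> e = s \<or> (E, e) \<in> x \<and> E \<noteq> A \<and> E \<noteq> B" for E e
    unfolding z by (rule two(5))
  note block = pointed_partition_block[OF assms(2)]
  note unique = pointed_partition_unique[OF assms(2)]
  show ?thesis
  proof (rule pointed_partitionsI)
    show "E \<subseteq> {1..n} \<and> e \<in> E" if "(E, e) \<in> z" for E e
      using that s block AB(1,2) unfolding z_iff by blast
    show "E = G \<and> e = g" if "(E, e) \<in> z" "(G, g) \<in> z" "i \<in> E" "i \<in> G" for E e G g i
    proof -
      have sub: "F = A \<union> B \<and> f = s \<or> (F, f) \<in> x \<and> F \<inter> (A \<union> B) = {}" if "(F, f) \<in> z" for F f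
        using that unique(1)[OF AB(1), of F f] unique(1)[OF AB(2), of F f] unfolding z_iff by blast
      show ?thesis
        using sub[OF that(1)] sub[OF that(2)] unique[of E e G g i] that(3,4) by blast
    qed
    show "\<exists>E e. (E, e) \<in> z \<and> i \<in> E" if i: "i \<in> {1..n}" for i
    proof -
      obtain E e where "(E, e) \<in> x" "i \<in> E" by (rule pointed_partition_cover[OF assms(2) i])
      then show ?thesis unfolding z_iff by blast
    qed
  qed
qed

lemma pointed_merge_pointed_refines:
  assumes "pointed_merge l x z" "x \<in> pointed_partitions n"
  shows "pointed_refines x z"
proof -
  obtain a b u where l: "l = (a, b, u)" by (cases l)
  obtain A p B q s where AB: "(A, p) \<in> x" "(B, q) \<in> x" "Min A = a" "Min B = b" "Min A < Min B"
    and s: "u = 1 \<and> s = p \<or> u = 0 \<and> s = q" and z: "z = insert (A \<union> B, s) (x - {(A, p), (B, q)})"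
    by (rule pointed_mergeE[OF assms(1)[unfolded l]])
  note two = pointed_partition_two_blocks[OF assms(2) AB(1,2,5)]
  have z_iff: "(E, e) \<in> z \<longleftrightarrow> E = A \<union> B \<and> e = s \<or> (E, e) \<in> x \<and> E \<noteq> A \<and> E \<noteq> B" for E e
    unfolding z by (rule two(5))
  have "\<exists>C r. (C, r) \<in> z \<and> E \<subseteq> C" if "(E, e) \<in> x" for E e
    using that unfolding z_iff by blast
  moreover have "e \<in> snd ` x" if "(E, e) \<in> z" for E e
    using that s AB(1,2) unfolding z_iff by force
  ultimately show ?thesis unfolding pointed_refines_def by force
qed

text \<open>The labels of the merges of \<open>x\<close> that stay below \<open>y\<close>, read off
  from \<open>x\<close> and \<open>y\<close> alone: both blocks lie in the same block
  \<open>C\<close> of \<open>y\<close>, and the forgotten pointer (\<open>p\<close> for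
  \<open>u = 0\<close>, \<open>q\<close> for \<open>u = 1\<close>) is not the pointer of
  \<open>C\<close>.\<close>

definition merge_labels :: "pointed_partition \<Rightarrow> pointed_partition \<Rightarrow> weighted_label set" where
  "merge_labels x y = {(Min A, Min B, u) | A p B q C r u.
     (A, p) \<in> x \<and> (B, q) \<in> x \<and> (C, r) \<in> y \<and> A \<subseteq> C \<and> B \<subseteq> C \<and> Min A < Min B \<and>
     (u = 0 \<and> p \<noteq> r \<or> u = 1 \<and> q \<noteq> r)}"

lemma merge_labelsI:
  "(A, p) \<in> x \<Longrightarrow> (B, q) \<in> x \<Longrightarrow> (C, r) \<in> y \<Longrightarrow> A \<subseteq> C \<Longrightarrow> B \<subseteq> C \<Longrightarrow> Min A < Min B \<Longrightarrow>
   u = 0 \<and> p \<noteq> r \<or> u = 1 \<and> q \<noteq> r \<Longrightarrow> (Min A, Min B, u) \<in> merge_labels x y"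
  unfolding merge_labels_def by blast

text \<open>The pointers \<open>p\<close> and \<open>q\<close> lie in disjoint blocks, so at most
  one of them is \<open>r\<close> and the other may be forgotten.\<close>

lemma merge_labels_ex:
  assumes "x \<in> pointed_partitions n" "(A, p) \<in> x" "(B, q) \<in> x" "(C, r) \<in> y"
    "A \<subseteq> C" "B \<subseteq> C" "Min A < Min B"
  obtains u where "(Min A, Min B, u) \<in> merge_labels x y"
proof -
  have "p \<noteq> q"
    using pointed_partition_unique(1)[OF assms(1-3)] pointed_partition_block(3)[OF assms(1)] assms
    by blast
  then have "p \<noteq> r \<or> q \<noteq> r" by auto
  then show ?thesis using merge_labelsI[OF assms(2-7)] that by blast
qed

lemma merge_labels_iff:
  assumes x: "x \<in> pointed_partitions n" and y: "y \<in> pointed_partitions n" and xy: "pointed_refines x y"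
  shows "l \<in> merge_labels x y \<longleftrightarrow> (\<exists>z. pointed_merge l x z \<and> pointed_refines z y)"
proof
  assume "l \<in> merge_labels x y"
  then obtain A p B q C r u where l: "l = (Min A, Min B, u)" and AB: "(A, p) \<in> x" "(B, q) \<in> x"
    and C: "(C, r) \<in> y" "A \<subseteq> C" "B \<subseteq> C" "Min A < Min B" "u = 0 \<and> p \<noteq> r \<or> u = 1 \<and> q \<noteq> r"
    unfolding merge_labels_def by blast
  define s where "s = (if u = 1 then p else q)"
  define z where "z = insert (A \<union> B, s) (x - {(A, p), (B, q)})"
  have "pointed_merge l x z"
    using AB C(4,5) unfolding l z_def s_def by auto
  moreover have "pointed_refines z y"
    unfolding pointed_refines_def
  proof (intro conjI allI impI subsetI)
    fix E e assume "(E, e) \<in> z"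
    then show "\<exists>C r. (C, r) \<in> y \<and> E \<subseteq> C"
      using C xy unfolding z_def pointed_refines_def by (metis DiffD1 Un_least insertE prod.inject)
  next
    fix e assume "e \<in> snd ` y"
    then obtain E where E: "(E, e) \<in> y" by force
    then have "e \<in> snd ` x" using xy unfolding pointed_refines_def by force
    then obtain F where F: "(F, e) \<in> x" by force
    \<comment> \<open>Only \<open>p\<close> or \<open>q\<close> can get lost. If \<open>e\<close> is
      one of them it lies in \<open>C\<close>, so it equals \<open>r\<close>, and the condition on
      \<open>u\<close> says that this pointer is kept.\<close>
    show "e \<in> snd ` z"
    proof (cases "(F, e) \<in> {(A, p), (B, q)}")
      case True
      then have "e \<in> C" using pointed_partition_block(3)[OF x F] C(2,3) by blast
      then have "e = r"
        using pointed_partition_unique(2)[OF y E C(1)] pointed_partition_block(3)[OF y E] by blast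
      then have "e = s" using True C(5) by (auto simp: s_def)
      then show ?thesis unfolding z_def by force
    next
      case False
      then show ?thesis using F unfolding z_def by force
    qed
  qed
  ultimately show "\<exists>z. pointed_merge l x z \<and> pointed_refines z y" by blast
next
  assume "\<exists>z. pointed_merge l x z \<and> pointed_refines z y"
  then obtain z where z: "pointed_merge l x z" "pointed_refines z y" by blast
  obtain a b u where l: "l = (a, b, u)" by (cases l)
  obtain A p B q s where AB: "(A, p) \<in> x" "(B, q) \<in> x" "Min A = a" "Min B = b" "Min A < Min B"
    and s: "u = 1 \<and> s = p \<or> u = 0 \<and> s = q" and z_eq: "z = insert (A \<union> B, s) (x - {(A, p), (B, q)})"
    by (rule pointed_mergeE[OF z(1)[unfolded l]])
  note two = pointed_partition_two_blocks[OF x AB(1,2,5)]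
  have z_iff: "(E, e) \<in> z \<longleftrightarrow> E = A \<union> B \<and> e = s \<or> (E, e) \<in> x \<and> E \<noteq> A \<and> E \<noteq> B" for E e
    unfolding z_eq by (rule two(5))
  obtain C r where C: "(C, r) \<in> y" "A \<union> B \<subseteq> C" using z(2) z_iff unfolding pointed_refines_def by blast
  \<comment> \<open>The pointer of \<open>C\<close> survives in \<open>z\<close>: it is the one kept
    by the merge or belongs to a block other than \<open>A\<close> and \<open>B\<close>. Either way
    the forgotten pointer is not \<open>r\<close>.\<close>
  have "r \<in> snd ` z" using z(2) C(1) unfolding pointed_refines_def by force
  then obtain E where "(E, r) \<in> z" by force
  then have "r = s \<or> (E, r) \<in> x \<and> E \<noteq> A \<and> E \<noteq> B" using z_iff by blast
  moreover have "r \<noteq> p" "r \<noteq> q" if "(E, r) \<in> x" "E \<noteq> A" "E \<noteq> B"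
    using pointed_partition_unique(1)[OF x that(1)] pointed_partition_block(3)[OF x] that AB(1,2)
    by metis+
  ultimately have "u = 0 \<and> p \<noteq> r \<or> u = 1 \<and> q \<noteq> r" using s two(2) by blast
  then show "l \<in> merge_labels x y"
    using merge_labelsI[OF AB(1,2) C(1) _ _ AB(5)] C(2) AB(3,4) unfolding l by blast
qed

text \<open>If no merge is admissible, no block of \<open>y\<close> contains two blocks of
  \<open>x\<close>, since two such blocks could always be merged with some weight. Then the blocks
  coincide and so do the pointers. This is what lets refinement be realised by successive
  merges.\<close>

lemma merge_labels_nonempty:
  assumes x: "x \<in> pointed_partitions n" and y: "y \<in> pointed_partitions n"
    and xy: "pointed_refines x y" "x \<noteq> y"
  shows "merge_labels x y \<noteq> {}"
proof
  assume empty: "merge_labels x y = {}"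
  have one: "A = B" if "(A, p) \<in> x" "(B, q) \<in> x" "(C, r) \<in> y" "A \<subseteq> C" "B \<subseteq> C" for A p B q C r
  proof (rule ccontr)
    assume "A \<noteq> B"
    then have "Min A \<noteq> Min B"
      using pointed_partition_unique(1)[OF x that(1,2)] pointed_partition_block(4)[OF x] that by metis
    then have "Min A < Min B \<or> Min B < Min A" by auto
    then show False using merge_labels_ex[OF x] that empty by (metis empty_iff)
  qed
  have eq: "A = C \<and> p = r" if A: "(A, p) \<in> x" and C: "(C, r) \<in> y" and AC: "A \<subseteq> C" for A p C r
  proof
    show "A = C"
    proof (rule ccontr)
      assume "A \<noteq> C"
      then obtain i where i: "i \<in> C" "i \<notin> A" using AC by blast
      then obtain B q where B: "(B, q) \<in> x" "i \<in> B"
        using pointed_partition_cover[OF x] pointed_partition_block(1)[OF y C] by blast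
      then have "B \<subseteq> C" using pointed_refines_subset[OF xy(1) y B(1) C B(2) i(1)] by blast
      then show False using one[OF A B(1) C AC] B i by blast
    qed
    have "r \<in> snd ` x" using xy(1) C unfolding pointed_refines_def by force
    then obtain B where B: "(B, r) \<in> x" by force
    then have "r \<in> B" "r \<in> C" using pointed_partition_block(3) x y C by blast+
    then show "p = r"
      using pointed_partition_unique(2)[OF x A B] \<open>A = C\<close> by blast
  qed
  have "x \<subseteq> y"
  proof clarify
    fix A p assume A: "(A, p) \<in> x"
    then obtain C r where "(C, r) \<in> y" "A \<subseteq> C" using xy(1) unfolding pointed_refines_def by blast
    with eq[OF A this] show "(A, p) \<in> y" by blast
  qed
  moreover have "y \<subseteq> x"
  proof clarify
    fix C r assume C: "(C, r) \<in> y"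
    then obtain A p where A: "(A, p) \<in> x" "r \<in> A"
      using pointed_partition_cover[OF x] pointed_partition_block(1,3)[OF y C] by blast
    then have "A \<subseteq> C"
      using pointed_refines_subset[OF xy(1) y A(1) C A(2)] pointed_partition_block(3)[OF y C] by blast
    with eq[OF A(1) C] A show "(C, r) \<in> x" by blast
  qed
  ultimately show False using xy(2) by blast
qed

section \<open>Refinement as the order of the poset\<close>

lemma pointed_refines_imp_merges:
  assumes "x \<in> pointed_partitions n" "y \<in> pointed_partitions n" "pointed_refines x y"
  shows "(\<lambda>\<sigma> \<tau>. \<exists>l. pointed_merge l \<sigma> \<tau>)\<^sup>*\<^sup>* x y"
  using assms
proof (induction "card x" arbitrary: x rule: less_induct)
  case less
  show ?case
  proof (cases "x = y")
    case False
    then obtain l z where z: "pointed_merge l x z" "pointed_refines z y"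
      using merge_labels_nonempty[OF less.prems] merge_labels_iff[OF less.prems] by blast
    have "(\<lambda>\<sigma> \<tau>. \<exists>l. pointed_merge l \<sigma> \<tau>)\<^sup>*\<^sup>* z y"
      using less.hyps[of z] pointed_merge_card[OF z(1) less.prems(1)]
        pointed_merge_in_pointed_partitions[OF z(1) less.prems(1)] z(2) less.prems(2) by simp
    then show ?thesis using z(1) by (metis (mono_tags, lifting) converse_rtranclp_into_rtranclp)
  qed simp
qed

text \<open>The comparison of block numbers is carried along because antisymmetry and the
  description of the covers rest on it.\<close>

lemma merges_imp_pointed_refines:
  assumes "(\<lambda>\<sigma> \<tau>. \<exists>l. pointed_merge l \<sigma> \<tau>)\<^sup>*\<^sup>* x y" "x \<in> pointed_partitions n"
  shows "y \<in> pointed_partitions n \<and> pointed_refines x y \<and> (x = y \<or> card y < card x)"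
  using assms
proof (induction rule: rtranclp_induct)
  case base
  then show ?case by (simp add: pointed_refines_refl)
next
  case (step y z)
  then obtain l where l: "pointed_merge l y z" and y: "y \<in> pointed_partitions n" by blast
  have "card y \<le> card x" "pointed_refines x y" using step by auto
  moreover from this(2) have "pointed_refines x z"
    by (rule pointed_refines_trans) (rule pointed_merge_pointed_refines[OF l y])
  ultimately show ?case
    using pointed_merge_in_pointed_partitions[OF l y] pointed_merge_card[OF l y] by simp
qed

lemma mem_pointed_partition_order:
  "(x, y) \<in> pointed_partition_order n \<longleftrightarrow>
     x \<in> pointed_partitions n \<and> y \<in> pointed_partitions n \<and> pointed_refines x y"
  using pointed_refines_imp_merges[of x n y] merges_imp_pointed_refines[of x y n]
  unfolding pointed_partition_order_def by blast

lemma pointed_refines_card: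
  assumes "x \<in> pointed_partitions n" "y \<in> pointed_partitions n" "pointed_refines x y" "x \<noteq> y"
  shows "card y < card x"
  using merges_imp_pointed_refines[OF pointed_refines_imp_merges[OF assms(1-3)] assms(1)] assms(4) by blast

lemma Field_pointed_partition_order: "Field (pointed_partition_order n) = pointed_partitions n"
proof (intro equalityI subsetI)
  fix x assume "x \<in> Field (pointed_partition_order n)"
  then obtain y where "(x, y) \<in> pointed_partition_order n \<or> (y, x) \<in> pointed_partition_order n"
    unfolding Field_def by blast
  then show "x \<in> pointed_partitions n" by (simp add: mem_pointed_partition_order) blast
next
  fix x assume "x \<in> pointed_partitions n"
  then have "(x, x) \<in> pointed_partition_order n"
    by (simp add: mem_pointed_partition_order pointed_refines_refl)
  then show "x \<in> Field (pointed_partition_order n)" by (rule FieldI1)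
qed

lemma finite_poset_pointed_partition_order: "finite_poset (pointed_partition_order n)"
proof -
  have "refl_on (pointed_partitions n) (pointed_partition_order n)"
    by (auto simp: refl_on_def mem_pointed_partition_order pointed_refines_refl)
  moreover have "trans (pointed_partition_order n)"
    by (rule transI) (auto simp: mem_pointed_partition_order elim: pointed_refines_trans)
  moreover have "antisym (pointed_partition_order n)"
    unfolding antisym_def mem_pointed_partition_order
    by (intro allI impI, rule ccontr) (use pointed_refines_card less_asym in metis)
  moreover have "pointed_partition_order n \<subseteq> pointed_partitions n \<times> pointed_partitions n"
    by (auto simp: mem_pointed_partition_order)
  ultimately show ?thesis
    unfolding finite_poset_def Field_pointed_partition_order order_on_defs
    using finite_pointed_partitions by blast
qed

lemma covers_pointed_partition_order:
  "covers (pointed_partition_order n) x z \<longleftrightarrow> x \<in> pointed_partitions n \<and> (\<exists>l. pointed_merge l x z)"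
proof
  assume c: "covers (pointed_partition_order n) x z"
  then have xz: "x \<in> pointed_partitions n" "z \<in> pointed_partitions n" "pointed_refines x z" "x \<noteq> z"
    by (auto simp: covers_def mem_pointed_partition_order)
  then obtain l w where w: "pointed_merge l x w" "pointed_refines w z"
    using merge_labels_nonempty[OF xz] merge_labels_iff[OF xz(1-3)] by blast
  have "w \<in> pointed_partitions n" "pointed_refines x w" "w \<noteq> x"
    using pointed_merge_in_pointed_partitions[OF w(1) xz(1)] pointed_merge_pointed_refines[OF w(1) xz(1)]
      pointed_merge_card[OF w(1) xz(1)] by auto
  then have "w = z" using c w(2) xz by (auto simp: covers_def mem_pointed_partition_order)
  then show "x \<in> pointed_partitions n \<and> (\<exists>l. pointed_merge l x z)" using w xz by blast
next
  assume "x \<in> pointed_partitions n \<and> (\<exists>l. pointed_merge l x z)"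
  then obtain l where x: "x \<in> pointed_partitions n" and l: "pointed_merge l x z" by blast
  have z: "z \<in> pointed_partitions n" "pointed_refines x z" "card x = Suc (card z)"
    using pointed_merge_in_pointed_partitions[OF l x] pointed_merge_pointed_refines[OF l x]
      pointed_merge_card[OF l x] by blast+
  have "w = x \<or> w = z" if "w \<in> pointed_partitions n" "pointed_refines x w" "pointed_refines w z" for w
    using pointed_refines_card[OF x that(1,2)] pointed_refines_card[OF that(1) z(1) that(3)] z(3) by fastforce
  then show "covers (pointed_partition_order n) x z"
    using x z by (auto simp: covers_def mem_pointed_partition_order)
qed

text \<open>The removed pairs \<open>x - z\<close> recover the two blocks, their minima tell which
  comes first, and the added pair \<open>z - x\<close> shows the pointer kept. Since
  \<open>p \<noteq> q\<close>, that pointer determines \<open>u\<close>.\<close>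

lemma bullet_label_eq:
  assumes "pointed_merge l x z" "x \<in> pointed_partitions n"
  shows "bullet_label x z = l"
  unfolding bullet_label_def
proof (rule the_equality)
  show "pointed_merge l x z" by (rule assms(1))
  fix l' assume l': "pointed_merge l' x z"
  obtain a b u where l: "l = (a, b, u)" by (cases l)
  obtain a' b' u' where l'_eq: "l' = (a', b', u')" by (cases l')
  obtain A p B q s where AB: "(A, p) \<in> x" "(B, q) \<in> x" "Min A = a" "Min B = b" "Min A < Min B"
    and s: "u = 1 \<and> s = p \<or> u = 0 \<and> s = q" and z: "z = insert (A \<union> B, s) (x - {(A, p), (B, q)})"
    by (rule pointed_mergeE[OF assms(1)[unfolded l]])
  note two = pointed_partition_two_blocks[OF assms(2) AB(1,2,5)]
  obtain A' p' B' q' s' where AB': "(A', p') \<in> x" "(B', q') \<in> x" "Min A' = a'" "Min B' = b'" "Min A' < Min B'"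
    and s': "u' = 1 \<and> s' = p' \<or> u' = 0 \<and> s' = q'" and z': "z = insert (A' \<union> B', s') (x - {(A', p'), (B', q')})"
    by (rule pointed_mergeE[OF l'[unfolded l'_eq]])
  note two' = pointed_partition_two_blocks[OF assms(2) AB'(1,2,5)]
  have "x - z = {(A, p), (B, q)}" using AB(1,2) two(4)[of s] unfolding z by auto
  moreover have "x - z = {(A', p'), (B', q')}" using AB'(1,2) two'(4)[of s'] unfolding z' by auto
  ultimately have "{(A, p), (B, q)} = {(A', p'), (B', q')}" by simp
  then have eq: "A = A'" "p = p'" "B = B'" "q = q'"
    using AB AB' by (auto simp: doubleton_eq_iff)
  have "z - x = {(A \<union> B, s)}" using two(4)[of s] unfolding z by auto
  moreover have "z - x = {(A' \<union> B', s')}" using two'(4)[of s'] unfolding z' by auto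
  ultimately have "s = s'" by simp
  then show "l' = l" using eq s s' two(2) AB(3,4) AB'(3,4) l l'_eq by auto
qed

text \<open>Minima identify the blocks of \<open>x\<close> and the weight selects the pointer to
  keep. This makes the atom with the least label unique.\<close>

lemma pointed_merge_functional:
  assumes "pointed_merge l x z" "pointed_merge l x z'" "x \<in> pointed_partitions n"
  shows "z = z'"
proof -
  obtain a b u where l: "l = (a, b, u)" by (cases l)
  obtain A p B q s where AB: "(A, p) \<in> x" "(B, q) \<in> x" "Min A = a" "Min B = b" "Min A < Min B"
    and s: "u = 1 \<and> s = p \<or> u = 0 \<and> s = q" and z: "z = insert (A \<union> B, s) (x - {(A, p), (B, q)})"
    by (rule pointed_mergeE[OF assms(1)[unfolded l]])
  obtain A' p' B' q' s' where AB': "(A', p') \<in> x" "(B', q') \<in> x" "Min A' = a" "Min B' = b" "Min A' < Min B'"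
    and s': "u = 1 \<and> s' = p' \<or> u = 0 \<and> s' = q'" and z': "z' = insert (A' \<union> B', s') (x - {(A', p'), (B', q')})"
    by (rule pointed_mergeE[OF assms(2)[unfolded l]])
  have "A = A' \<and> p = p'"
    using pointed_partition_unique[OF assms(3) AB(1) AB'(1), of a]
      pointed_partition_block(4)[OF assms(3)] AB AB' by metis
  moreover have "B = B' \<and> q = q'"
    using pointed_partition_unique[OF assms(3) AB(2) AB'(2), of b]
      pointed_partition_block(4)[OF assms(3)] AB AB' by metis
  ultimately show ?thesis using z z' s s' by auto
qed

section \<open>The labeling of the poset of pointed partitions\<close>

text \<open>The comparison of labels freed from the range conditions on their entries, which
  \<open>merge_labels_subset\<close> supplies separately.\<close>

fun label_le :: "weighted_label \<Rightarrow> weighted_label \<Rightarrow> bool" where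
  "label_le (a, b, u) (a', c, v) \<longleftrightarrow> a < a' \<or> a = a' \<and> b \<le> c \<and> u \<le> v"

lemma mem_weighted_label_order:
  "(l, l') \<in> weighted_label_order n \<longleftrightarrow>
     l \<in> (\<Union>a\<in>{1..n - 1}. weighted_labels n a) \<and> l' \<in> (\<Union>a\<in>{1..n - 1}. weighted_labels n a) \<and>
     label_le l l'"
  by (cases l; cases l') (auto simp: weighted_label_order_def weighted_labels_def)

lemma Partial_order_weighted_label_order: "Partial_order (weighted_label_order n)"
proof -
  let ?L = "\<Union>a\<in>{1..n - 1}. weighted_labels n a"
  have refl: "label_le l l" for l by (cases l) simp
  have "l \<in> Field (weighted_label_order n) \<longleftrightarrow> l \<in> ?L" for l
    using mem_weighted_label_order refl unfolding Field_def by blast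
  then have Field: "Field (weighted_label_order n) = ?L" by blast
  have "trans (weighted_label_order n)"
  proof (rule transI)
    fix l l' l'' assume "(l, l') \<in> weighted_label_order n" "(l', l'') \<in> weighted_label_order n"
    then show "(l, l'') \<in> weighted_label_order n"
      unfolding mem_weighted_label_order by (cases l; cases l'; cases l'') auto
  qed
  moreover have "antisym (weighted_label_order n)"
  proof (rule antisymI)
    fix l l' assume "(l, l') \<in> weighted_label_order n" "(l', l) \<in> weighted_label_order n"
    then show "l = l'"
      unfolding mem_weighted_label_order by (cases l; cases l') auto
  qed
  moreover have "refl_on ?L (weighted_label_order n)"
    using mem_weighted_label_order refl unfolding refl_on_def by blast
  moreover have "weighted_label_order n \<subseteq> ?L \<times> ?L"
  proof
    fix e assume "e \<in> weighted_label_order n"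
    then show "e \<in> ?L \<times> ?L"
      using mem_weighted_label_order[of "fst e" "snd e"] by (cases e) simp
  qed
  ultimately show ?thesis unfolding order_on_defs Field by blast
qed

lemma merge_labels_subset:
  assumes "x \<in> pointed_partitions n"
  shows "merge_labels x y \<subseteq> (\<Union>a\<in>{1..n - 1}. weighted_labels n a)"
proof
  fix l assume "l \<in> merge_labels x y"
  then obtain A p B q u where l: "l = (Min A, Min B, u)" and AB: "(A, p) \<in> x" "(B, q) \<in> x"
    "Min A < Min B" and u: "u = 0 \<or> u = 1"
    unfolding merge_labels_def by blast
  have "Min A \<in> {1..n}" "Min B \<in> {1..n}"
    using pointed_partition_block(1,4)[OF assms AB(1)] pointed_partition_block(1,4)[OF assms AB(2)]
    by blast+
  then show "l \<in> (\<Union>a\<in>{1..n - 1}. weighted_labels n a)"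
    using AB(3) u unfolding l weighted_labels_def by auto
qed

lemma merge_labels_least:
  assumes x: "x \<in> pointed_partitions n" and y: "y \<in> pointed_partitions n"
    and xy: "pointed_refines x y" "x \<noteq> y"
  obtains l where "l \<in> merge_labels x y" "\<And>l'. l' \<in> merge_labels x y \<Longrightarrow> label_le l l'"
proof -
  let ?L = "merge_labels x y"
  define a where "a = (LEAST a. \<exists>b u. (a, b, u) \<in> ?L)"
  have "\<exists>a b u. (a, b, u) \<in> ?L" using merge_labels_nonempty[OF x y xy] by fastforce
  then have a: "\<exists>b u. (a, b, u) \<in> ?L" unfolding a_def by (rule LeastI_ex)
  have a_le: "a \<le> a'" if "(a', b, u) \<in> ?L" for a' b u
    unfolding a_def by (rule Least_le) (use that in blast)
  define b where "b = (LEAST b. \<exists>u. (a, b, u) \<in> ?L)"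
  have b: "\<exists>u. (a, b, u) \<in> ?L" unfolding b_def by (rule LeastI_ex) (rule a)
  have b_le: "b \<le> b'" if "(a, b', u) \<in> ?L" for b' u
    unfolding b_def by (rule Least_le) (use that in blast)
  define u where "u = (LEAST u. (a, b, u) \<in> ?L)"
  have u: "(a, b, u) \<in> ?L" unfolding u_def by (rule LeastI_ex) (rule b)
  \<comment> \<open>Here \<open>u\<close> has to be minimal over all second entries, not only over
    \<open>b\<close>. A label of weight 0 shows that the pointer of the block with minimum
    \<open>a\<close> is not \<open>r\<close>; this does not involve the partner, so weight 0 occurs
    with \<open>b\<close> too.\<close>
  have u_le: "u \<le> u'" if l: "(a, b', u') \<in> ?L" for b' u'
  proof (cases "u' = 0")
    case True
    obtain A p B' q' C r where A: "(A, p) \<in> x" "(C, r) \<in> y" "A \<subseteq> C" "Min A = a" "p \<noteq> r"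
      using l True unfolding merge_labels_def by auto
    obtain A' p' B q C' r' where B: "(A', p') \<in> x" "(B, q) \<in> x" "(C', r') \<in> y" "A' \<subseteq> C'" "B \<subseteq> C'"
      "Min A' = a" "Min B = b" "Min A' < Min B"
      using u unfolding merge_labels_def by auto
    have aA: "a \<in> A" "a \<in> A'"
      using pointed_partition_block(4)[OF x A(1)] pointed_partition_block(4)[OF x B(1)] A(4) B(6) by auto
    have "A' = A" "p' = p" using pointed_partition_unique[OF x B(1) A(1) aA(2,1)] by auto
    moreover from this have "r' = r"
      using pointed_partition_unique(2)[OF y B(3) A(2), of a] aA A(3) B(4) by blast
    ultimately have "(a, b, 0) \<in> ?L" using merge_labelsI[OF B(1-5) B(8), of 0] A(5) B(6,7) by simp
    then have "u \<le> 0" unfolding u_def by (rule Least_le)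
    then show ?thesis by simp
  next
    case False
    moreover have "u \<le> 1" using u unfolding merge_labels_def by auto
    ultimately show ?thesis by simp
  qed
  have "label_le (a, b, u) l'" if "l' \<in> ?L" for l'
  proof -
    obtain a' b' u' where l': "l' = (a', b', u')" by (cases l')
    show ?thesis
    proof (cases "a' = a")
      case True
      then show ?thesis using that l' b_le u_le by auto
    next
      case False
      then show ?thesis using that l' a_le by (auto simp: le_less)
    qed
  qed
  with u show ?thesis by (rule that)
qed

text \<open>Below \<open>D\<close> denotes the block created by the merge with label \<open>l\<close>. A merge of \<open>z\<close> not involving
  \<open>D\<close> is a merge of \<open>x\<close>; one that absorbs another block into \<open>D\<close> is compared with the merge of
  \<open>x\<close> absorbing that block into the part \<open>A\<close> of \<open>D\<close> containing \<open>Min D\<close>.\<close>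

lemma least_merge_label_iff:
  assumes x: "x \<in> pointed_partitions n" and y: "y \<in> pointed_partitions n"
    and xz: "pointed_merge l x z" and zy: "pointed_refines z y"
  shows "(\<forall>l'\<in>merge_labels z y. label_le l l') \<longleftrightarrow> (\<forall>l'\<in>merge_labels x y. label_le l l')"
    and "l \<notin> merge_labels z y"
proof -
  have z: "z \<in> pointed_partitions n" by (rule pointed_merge_in_pointed_partitions[OF xz x])
  obtain a b v where l: "l = (a, b, v)" by (cases l)
  obtain A p B q s where AB: "(A, p) \<in> x" "(B, q) \<in> x" "Min A = a" "Min B = b" "Min A < Min B"
    and s: "v = 1 \<and> s = p \<or> v = 0 \<and> s = q" and z_eq: "z = insert (A \<union> B, s) (x - {(A, p), (B, q)})"
    by (rule pointed_mergeE[OF xz[unfolded l]])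
  note two = pointed_partition_two_blocks[OF x AB(1,2,5)]
  define D where "D = A \<union> B"
  have z_iff: "(E, e) \<in> z \<longleftrightarrow> E = D \<and> e = s \<or> (E, e) \<in> x \<and> E \<noteq> A \<and> E \<noteq> B" for E e
    unfolding z_eq D_def by (rule two(5))
  have minD: "Min D = a" using two(3) AB(3) by (simp add: D_def)
  have Dz: "(D, s) \<in> z" using z_iff by blast
  note blx = pointed_partition_block[OF x] and blz = pointed_partition_block[OF z]
  note uny = pointed_partition_unique[OF y]
  obtain C r where C: "(C, r) \<in> y" "D \<subseteq> C" using zy Dz unfolding pointed_refines_def by blast
  have AC: "A \<subseteq> C" and BC: "B \<subseteq> C" using C(2) by (auto simp: D_def)
  have sub_C: "(C', r') = (C, r)" if "(C', r') \<in> y" "i \<in> C'" "i \<in> C" for C' r' i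
    using uny[OF that(1) C(1) that(2,3)] by simp

  \<comment> \<open>After the merge \<open>b\<close> lies in \<open>D\<close>, whose minimum is
    \<open>a\<close>, so no block of \<open>z\<close> has minimum \<open>b\<close>. This makes the
    later comparison with labels of \<open>z\<close> strict.\<close>
  show "l \<notin> merge_labels z y"
  proof
    assume "l \<in> merge_labels z y"
    then obtain E e where E: "(E, e) \<in> z" "Min E = b" unfolding merge_labels_def l by blast
    have "b \<in> E" using blz(4)[OF E(1)] E(2) by simp
    moreover have "b \<in> D" using blx(4)[OF AB(2)] AB(4) by (simp add: D_def)
    ultimately have "E = D" using pointed_partition_unique(1)[OF z E(1) Dz] by blast
    then show False using E(2) minD AB(3-5) by simp
  qed

  show "(\<forall>l'\<in>merge_labels z y. label_le l l') \<longleftrightarrow> (\<forall>l'\<in>merge_labels x y. label_le l l')"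
  proof (intro iffI ballI)
    fix l' assume min: "\<forall>l'\<in>merge_labels x y. label_le l l'" and "l' \<in> merge_labels z y"
    then obtain A' p' B' q' C' r' u' where l': "l' = (Min A', Min B', u')"
      and A'B': "(A', p') \<in> z" "(B', q') \<in> z" and C': "(C', r') \<in> y" "A' \<subseteq> C'" "B' \<subseteq> C'"
      and lt: "Min A' < Min B'" and u': "u' = 0 \<and> p' \<noteq> r' \<or> u' = 1 \<and> q' \<noteq> r'"
      unfolding merge_labels_def by blast
    consider "(A', p') \<in> x" "(B', q') \<in> x" | "A' = D" "p' = s" "(B', q') \<in> x"
      | "(A', p') \<in> x" "B' = D"
      using A'B' z_iff lt by fastforce
    then show "label_le l l'"
    proof cases
      case 1
      then show ?thesis using min merge_labelsI[OF 1 C' lt u'] l' by blast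
    next
      case 2
      have AC': "A \<subseteq> C'" using 2 C' by (auto simp: D_def)
      have lt': "Min A < Min B'" using lt 2 minD AB(3) by simp
      note in_x = merge_labelsI[OF AB(1) 2(3) C'(1) AC' C'(3) lt']
      \<comment> \<open>The label of absorbing \<open>B'\<close> into \<open>A\<close> may be forced
        to have weight 1 while \<open>u' = 0\<close>. In that case \<open>p = r'\<close> but
        \<open>s \<noteq> r'\<close>, so \<open>l\<close> did not keep \<open>p\<close>; hence
        \<open>v = 0\<close> and the weights still compare.\<close>
      show ?thesis
      proof (cases "q' \<noteq> r' \<and> (u' = 1 \<or> p = r')")
        case True
        then have le: "label_le l (a, Min B', 1)" using min in_x[of 1] AB(3) by simp
        show ?thesis
        proof (cases "u' = 1")
          case True
          then show ?thesis using le l' 2 minD by simp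
        next
          case False
          then have "p = r'" "s \<noteq> r'" using True u' 2 by auto
          then have "v = 0" using s by auto
          then show ?thesis using le l' 2 minD l by simp
        qed
      next
        case False
        have "p \<noteq> r' \<and> u' = 0"
        proof (cases "p = r'")
          case True
          then have "q' = r'" using False by simp
          then have "B' \<inter> A \<noteq> {}" using True blx(3)[OF AB(1)] blx(3)[OF 2(3)] by auto
          then have "B' = A" using pointed_partition_unique(1)[OF x 2(3) AB(1)] by blast
          then show ?thesis using lt' by simp
        qed (use False u' in auto)
        then show ?thesis using min in_x[of 0] AB(3) l' 2 minD by simp
      qed
    next
      case 3
      \<comment> \<open>Using \<open>A\<close> in place of \<open>D\<close> gives a label of
        \<open>x\<close> with first entry below \<open>a\<close>, so minimality of \<open>l\<close>
        rules this case out.\<close>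
      have "Min A' < Min A" using lt 3(2) minD AB(3) by simp
      moreover have "A \<subseteq> C'" using 3 C' by (auto simp: D_def)
      ultimately obtain w where "(Min A', Min A, w) \<in> merge_labels x y"
        using merge_labels_ex[OF x 3(1) AB(1) C'(1,2)] by blast
      then have "label_le l (Min A', Min A, w)" using min by blast
      then show ?thesis using \<open>Min A' < Min A\<close> AB(3) l by simp
    qed
  next
    fix l' assume min: "\<forall>l'\<in>merge_labels z y. label_le l l'" and "l' \<in> merge_labels x y"
    then obtain A' p' B' q' C' r' u' where l': "l' = (Min A', Min B', u')"
      and A'B': "(A', p') \<in> x" "(B', q') \<in> x" and C': "(C', r') \<in> y" "A' \<subseteq> C'" "B' \<subseteq> C'"
      and lt: "Min A' < Min B'" and u': "u' = 0 \<and> p' \<noteq> r' \<or> u' = 1 \<and> q' \<noteq> r'"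
      unfolding merge_labels_def by blast
    \<comment> \<open>Any block of \<open>z\<close> inside \<open>C\<close> with minimum other than
      \<open>a\<close> can be merged with \<open>D\<close> with some weight; this alone bounds its
      minimum, here and in \<open>larger\<close>.\<close>
    have no_smaller: "a \<le> Min E" if E: "(E, e) \<in> z" "E \<subseteq> C" for E e
    proof (rule ccontr)
      assume "\<not> a \<le> Min E"
      then have lt: "Min E < Min D" using minD by simp
      obtain w where "(Min E, Min D, w) \<in> merge_labels z y"
        by (rule merge_labels_ex[OF z E(1) Dz C(1) E(2) C(2) lt])
      then have "label_le l (Min E, Min D, w)" using min by blast
      then show False using lt minD l by simp
    qed
    have larger: "b \<le> Min E" if E: "(E, e) \<in> z" "E \<subseteq> C" "a < Min E" for E e
    proof -
      have lt: "Min D < Min E" using minD E(3) by simp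
      obtain w where "(Min D, Min E, w) \<in> merge_labels z y"
        by (rule merge_labels_ex[OF z Dz E(1) C(1,2) E(2) lt])
      then have "label_le l (Min D, Min E, w)" using min by blast
      then show ?thesis using minD l by simp
    qed
    \<comment> \<open>If \<open>v = 1\<close>, then \<open>D\<close> has pointer \<open>p\<close>,
      so \<open>r\<close> is the pointer of another block \<open>E\<close> of \<open>z\<close>
      inside \<open>C\<close>. The 0-merge of \<open>D\<close> and \<open>E\<close> only forgets
      \<open>p\<close>, and its label has first entry \<open>a\<close> and weight 0, hence is not
      above \<open>l\<close>.\<close>
    have v0: "v = 0" if "p \<noteq> r"
    proof (rule ccontr)
      assume "v \<noteq> 0"
      then have v: "v = 1" "s = p" using s by auto
      have "r \<in> snd ` z" using zy C(1) unfolding pointed_refines_def by force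
      then obtain E where E: "(E, r) \<in> z" by force
      have "r \<in> E" by (rule blz(3)[OF E])
      have "E \<noteq> D"
      proof
        assume "E = D"
        then have "r = s" using pointed_partition_unique(2)[OF z E Dz] \<open>r \<in> E\<close> by blast
        then show False using v that by simp
      qed
      have EC: "E \<subseteq> C"
        using pointed_refines_subset[OF zy y E C(1)] \<open>r \<in> E\<close> pointed_partition_block(3)[OF y C(1)]
        by blast
      have "Min E \<noteq> a"
      proof
        assume "Min E = a"
        then have "a \<in> E" using blz(4)[OF E] by simp
        moreover have "a \<in> D" using blz(4)[OF Dz] minD by simp
        ultimately show False using pointed_partition_unique(1)[OF z E Dz] \<open>E \<noteq> D\<close> by blast
      qed
      then have "Min D < Min E" using no_smaller[OF E EC] minD by simp
      then have "(Min D, Min E, 0) \<in> merge_labels z y"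
        using merge_labelsI[OF Dz E C(1,2) EC] v that by simp
      then have "label_le l (Min D, Min E, 0)" using min by blast
      then show False using v l minD by simp
    qed
    have C'C: "(C', r') = (C, r)" if "A' = A \<or> A' = B \<or> B' = A \<or> B' = B"
    proof -
      have "A' \<subseteq> C \<or> B' \<subseteq> C" using that AC BC by blast
      then obtain i where "i \<in> C'" "i \<in> C" using C'(2,3) blx(3)[OF A'B'(1)] blx(3)[OF A'B'(2)] by blast
      then show ?thesis using sub_C[OF C'(1)] by blast
    qed
    \<comment> \<open>In the third and fifth cases the first entry of \<open>l'\<close> exceeds
      \<open>a\<close>, and the fourth cannot occur. Only \<open>A' = A\<close> requires comparing
      second entries and weights.\<close>
    consider "A' \<noteq> A" "A' \<noteq> B" "B' \<noteq> A" "B' \<noteq> B" | "A' = A" | "A' = B"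
      | "B' = A" "A' \<noteq> B" "A' \<noteq> A" | "B' = B" "A' \<noteq> B" "A' \<noteq> A" by blast
    then show "label_le l l'"
    proof cases
      case 1
      then have "(A', p') \<in> z" "(B', q') \<in> z" using A'B' z_iff by blast+
      then show ?thesis using min merge_labelsI[OF _ _ C' lt u'] l' by blast
    next
      case 2
      then have p': "p' = p" using pointed_partition_unique(2)[OF x A'B'(1) AB(1)] blx(3)[OF AB(1)] by blast
      have C'_eq: "C' = C" "r' = r" using C'C 2 by auto
      have "b \<le> Min B'"
      proof (cases "B' = B")
        case False
        moreover have "B' \<noteq> A" using lt 2 by auto
        ultimately have "(B', q') \<in> z" using z_iff A'B' by blast
        then show ?thesis using larger C'(3) C'_eq lt 2 AB(3) by simp
      qed (use AB in simp)
      moreover have "v \<le> u'"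
      proof (cases "u' = 0")
        case True
        then show ?thesis using v0 u' p' C'_eq by simp
      qed (use u' s in auto)
      ultimately show ?thesis using l l' 2 AB(3) by simp
    next
      case 3
      then show ?thesis using l l' AB by simp
    next
      case 4
      then have "(A', p') \<in> z" using z_iff A'B' by blast
      then have "a \<le> Min A'" using no_smaller C'(2) C'C 4 by simp
      then show ?thesis using lt 4 AB(3) by simp
    next
      case 5
      then have A': "(A', p') \<in> z" using z_iff A'B' by blast
      then have "a \<le> Min A'" using no_smaller C'(2) C'C 5 by simp
      moreover have "Min A' \<noteq> a"
      proof
        assume "Min A' = a"
        then have "a \<in> A'" "a \<in> A" using blx(4)[OF A'B'(1)] blx(4)[OF AB(1)] AB(3) by auto
        then show False using pointed_partition_unique(1)[OF x A'B'(1) AB(1)] 5 by blast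
      qed
      ultimately show ?thesis using l l' by simp
    qed
  qed
qed

section \<open>Least labels and the EL-labeling\<close>

definition least_merge_label :: "pointed_partition \<Rightarrow> pointed_partition \<Rightarrow> weighted_label" where
  "least_merge_label x y = (SOME l. l \<in> merge_labels x y \<and> (\<forall>l'\<in>merge_labels x y. label_le l l'))"

lemma least_merge_label:
  assumes "x \<in> pointed_partitions n" "y \<in> pointed_partitions n" "pointed_refines x y" "x \<noteq> y"
  shows "least_merge_label x y \<in> merge_labels x y"
    and "l \<in> merge_labels x y \<Longrightarrow> label_le (least_merge_label x y) l"
proof -
  have "\<exists>l. l \<in> merge_labels x y \<and> (\<forall>l'\<in>merge_labels x y. label_le l l')"
    using merge_labels_least[OF assms] by metis
  from someI_ex[OF this, folded least_merge_label_def]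
  show "least_merge_label x y \<in> merge_labels x y"
    and "l \<in> merge_labels x y \<Longrightarrow> label_le (least_merge_label x y) l" by auto
qed

lemma label_le_antisym: "label_le l l' \<Longrightarrow> label_le l' l \<Longrightarrow> l = l'"
  by (cases l; cases l') auto

lemma label_le_trans: "label_le l l' \<Longrightarrow> label_le l' l'' \<Longrightarrow> label_le l l''"
  by (cases l; cases l'; cases l'') auto

lemma EL_labeling_pointed_partitions:
  "EL_labeling (pointed_partition_order n) (weighted_label_order n) bullet_label"
proof (rule EL_labelingI[where low = least_merge_label])
  show "finite_poset (pointed_partition_order n)" by (rule finite_poset_pointed_partition_order)
  show "Partial_order (weighted_label_order n)" by (rule Partial_order_weighted_label_order)
  have atom: "x \<in> pointed_partitions n \<and> y \<in> pointed_partitions n \<and> z \<in> pointed_partitions n \<and>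
      pointed_refines x y \<and> pointed_refines z y \<and> x \<noteq> y \<and> pointed_merge (bullet_label x z) x z \<and>
      bullet_label x z \<in> merge_labels x y"
    if c: "covers (pointed_partition_order n) x z" and zy: "(z, y) \<in> pointed_partition_order n" for x y z
  proof -
    obtain l where l: "x \<in> pointed_partitions n" "pointed_merge l x z"
      using c covers_pointed_partition_order by blast
    have yz: "z \<in> pointed_partitions n" "y \<in> pointed_partitions n" "pointed_refines z y"
      using zy mem_pointed_partition_order by blast+
    have xy: "pointed_refines x y"
      using pointed_refines_trans[OF pointed_merge_pointed_refines[OF l(2,1)] yz(3)] .
    have m: "bullet_label x z = l" by (rule bullet_label_eq[OF l(2,1)])
    have "l \<in> merge_labels x y" using merge_labels_iff[OF l(1) yz(2) xy] l(2) yz(3) by blast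
    moreover have "x \<noteq> y"
    proof
      assume "x = y"
      then have "(z, x) \<in> pointed_partition_order n" using zy by simp
      moreover have "(x, z) \<in> pointed_partition_order n" "x \<noteq> z" using c by (auto simp: covers_def)
      ultimately show False
        using finite_poset_pointed_partition_order[of n]
        by (auto simp: finite_poset_def order_on_defs dest: antisymD)
    qed
    ultimately show ?thesis using l yz xy m by blast
  qed
  note in_order = mem_weighted_label_order
  show "(least_merge_label x y, bullet_label x z) \<in> weighted_label_order n"
    if "covers (pointed_partition_order n) x z" "(z, y) \<in> pointed_partition_order n" for x y z
    using atom[OF that] least_merge_label[of x n y] merge_labels_subset[of x n y]
    unfolding in_order by blast
  show "\<exists>!z. covers (pointed_partition_order n) x z \<and> (z, y) \<in> pointed_partition_order n \<and>
      bullet_label x z = least_merge_label x y"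
    if "(x, y) \<in> pointed_partition_order n" "x \<noteq> y" for x y
  proof -
    have xy: "x \<in> pointed_partitions n" "y \<in> pointed_partitions n" "pointed_refines x y"
      using that mem_pointed_partition_order by blast+
    have "least_merge_label x y \<in> merge_labels x y" by (rule least_merge_label[OF xy that(2)])
    then obtain z where z: "pointed_merge (least_merge_label x y) x z" "pointed_refines z y"
      using merge_labels_iff[OF xy] by blast
    show ?thesis
    proof (rule ex1I[of _ z], intro conjI)
      show "covers (pointed_partition_order n) x z"
        using z xy covers_pointed_partition_order by blast
      show "(z, y) \<in> pointed_partition_order n"
        using z xy pointed_merge_in_pointed_partitions mem_pointed_partition_order by blast
      show "bullet_label x z = least_merge_label x y" by (rule bullet_label_eq[OF z(1) xy(1)])
      fix z' assume "covers (pointed_partition_order n) x z' \<and> (z', y) \<in> pointed_partition_order n \<and>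
        bullet_label x z' = least_merge_label x y"
      with atom[of x z' y] have "pointed_merge (least_merge_label x y) x z'" by simp
      then show "z' = z" using pointed_merge_functional[OF _ z(1) xy(1)] by blast
    qed
  qed
  show "(bullet_label x z, least_merge_label z y) \<in> weighted_label_order n - Id \<longleftrightarrow>
      bullet_label x z = least_merge_label x y"
    if c: "covers (pointed_partition_order n) x z" and zy: "(z, y) \<in> pointed_partition_order n"
      and ne: "z \<noteq> y" for x y z
  proof -
    let ?l = "bullet_label x z"
    from atom[OF c zy] have pp: "x \<in> pointed_partitions n" "y \<in> pointed_partitions n"
      "z \<in> pointed_partitions n" and le: "pointed_refines x y" "pointed_refines z y" "x \<noteq> y"
      and l: "pointed_merge ?l x z" "?l \<in> merge_labels x y" by blast+
    note iff = least_merge_label_iff[OF pp(1,2) l(1) le(2)]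
    note lx = least_merge_label[OF pp(1,2) le(1,3)] and lz = least_merge_label[OF pp(3,2) le(2) ne]
    \<comment> \<open>Since \<open>?l\<close> is itself a label for \<open>x\<close>, being the
      least one means being a lower bound. This property passes between \<open>x\<close> and
      \<open>z\<close>, and over \<open>z\<close> it is a comparison with the least label
      only.\<close>
    have "?l = least_merge_label x y \<longleftrightarrow> (\<forall>l'\<in>merge_labels x y. label_le ?l l')"
      using lx l(2) label_le_antisym by metis
    also have "\<dots> \<longleftrightarrow> (\<forall>l'\<in>merge_labels z y. label_le ?l l')" using iff(1) by blast
    also have "\<dots> \<longleftrightarrow> label_le ?l (least_merge_label z y)"
      using lz label_le_trans by blast
    also have "\<dots> \<longleftrightarrow> (?l, least_merge_label z y) \<in> weighted_label_order n - Id"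
    proof -
      have "?l \<in> (\<Union>a\<in>{1..n - 1}. weighted_labels n a)"
        "least_merge_label z y \<in> (\<Union>a\<in>{1..n - 1}. weighted_labels n a)"
        using lz(1) l(2) merge_labels_subset[OF pp(1)] merge_labels_subset[OF pp(3)] by blast+
      moreover have "?l \<noteq> least_merge_label z y" using lz(1) iff(2) by auto
      ultimately show ?thesis unfolding Diff_iff in_order pair_in_Id_conv by blast
    qed
    finally show ?thesis by blast
  qed
qed

lemma pointed_bottom_least:
  assumes "m \<in> pointed_partitions n"
  shows "(pointed_bottom n, m) \<in> pointed_partition_order n"
  unfolding mem_pointed_partition_order
proof (intro conjI assms)
  have bot: "(A, p) \<in> pointed_bottom n \<longleftrightarrow> p \<in> {1..n} \<and> A = {p}" for A p
    by (auto simp: pointed_bottom_def)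
  show "pointed_bottom n \<in> pointed_partitions n"
    by (rule pointed_partitionsI) (auto simp: bot)
  have "\<exists>C r. (C, r) \<in> m \<and> A \<subseteq> C" if "(A, p) \<in> pointed_bottom n" for A p
    using that bot pointed_partition_cover[OF assms, of p] by (metis empty_subsetI insert_subset)
  moreover have "snd ` m \<subseteq> snd ` pointed_bottom n"
  proof clarify
    fix A p assume "(A, p) \<in> m"
    then have "p \<in> {1..n}" using pointed_partition_block(1,3)[OF assms] by blast
    then have "({p}, p) \<in> pointed_bottom n" using bot by blast
    then show "snd (A, p) \<in> snd ` pointed_bottom n" by force
  qed
  ultimately show "pointed_refines (pointed_bottom n) m" unfolding pointed_refines_def by blast
qed

theorem theorem2p14:
  fixes n :: nat
  assumes "n \<ge> 1"
  shows "EL_labeling (pointed_partition_order n) (weighted_label_order n) bullet_label \<and>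
         EL_shellable (pointed_partition_order n) \<and>
         (\<forall>m. maximal_element (pointed_partition_order n) m \<longrightarrow>
            cohen_macaulay_poset TYPE('k::comm_ring_1)
              (closed_interval (pointed_partition_order n) (pointed_bottom n) m))"
proof (intro conjI allI impI)
  show EL: "EL_labeling (pointed_partition_order n) (weighted_label_order n) bullet_label"
    by (rule EL_labeling_pointed_partitions)
  then show "EL_shellable (pointed_partition_order n)" by (rule EL_labeling_imp_EL_shellable)
  fix m assume "maximal_element (pointed_partition_order n) m"
  then have "m \<in> pointed_partitions n"
    by (simp add: maximal_element_def Field_pointed_partition_order)
  \<comment> \<open>Minus the number of blocks is the rank: each merge removes exactly one
    block.\<close>
  moreover have "- int (card z) = - int (card x) + 1"
    if c: "covers (pointed_partition_order n) x z" for x z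
  proof -
    obtain l where "pointed_merge l x z" "x \<in> pointed_partitions n"
      using c covers_pointed_partition_order by blast
    from pointed_merge_card[OF this] show ?thesis by simp
  qed
  ultimately show "cohen_macaulay_poset TYPE('k)
      (closed_interval (pointed_partition_order n) (pointed_bottom n) m)"
    using graded_EL_labeling_cohen_macaulay[where rank = "\<lambda>x. - int (card x)", OF EL]
      pointed_bottom_least by blast
qed

end
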